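(* Let $m\ge 0$ and $n\ge 1$ be integers. Let $Z_\lambda\sim\mathcal{L}_\lambda$, $\lambda>0$, be a family of random variables closed under independent addition with $EZ_\lambda^{2m}<\infty$, and suppose that the associated polynomials $\{P_\lambda^k(x)\}_{0\le k\le m}$ are monic, have degree $k$, are orthogonal with respect to $\mathcal{L}_\lambda$, and satisfy $E[P_\lambda^k(Z_\lambda)]^2>0$. Suppose further that, for some weights $c_{\mathbf m}$, the identity $$P_\lambda^m(w)=\sum_{\mathbf m:|\mathbf m|=m}c_{\mathbf m}\,P^{\mathbf m}_{\boldsymbol\lambda}(\mathbf x)$$ holds for all positive $\lambda_1,\ldots,\lambda_n$ and all $\mathbf x=(x_1,\ldots,x_n)\in\mathbf{R}^n$, where $\lambda=\lambda_1+\cdots+\lambda_n$ and $w=x_1+\cdots+x_n$. Then $$\alpha_\lambda^{(m)}=\sum_{\mathbf m:|\mathbf m|=m}c_{\mathbf m}\,\alpha_{\boldsymbol\lambda}^{(\mathbf m)},$$ and one may consider a random multi-index $\mathbf I=(I_1,\ldots,I_n)$, independent of all other variables, with distribution $$P(\mathbf I=\mathbf m)=c_{\mathbf m}\frac{\alpha_{\boldsymbol\lambda}^{(\mathbf m)}}{\alpha_\lambda^{(m)}},\qquad |\mathbf m|=m.$$ Furthermore, for any positive $\lambda_1,\ldots,\lambda_n$ and independent variables $X_1,\ldots,X_n$ with $X_i\in\mathcal{M}_{\lambda_i}^m$ and $W=\sum_{i=1}^nX_i$, the variable $$W_\lambda^{(m)}=\sum_{i=1}^n (X_i)_{\lambda_i}^{(I_i)}$$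 has the $W$-$P_\lambda^m$ biased distribution.
   Context: The family $\{\mathcal{L}_\lambda\}$ is closed under independent addition if for independent $Z_{\lambda_i}\sim\mathcal{L}_{\lambda_i}$, $i=1,2$, one has $Z_{\lambda_1}+Z_{\lambda_2}\sim\mathcal{L}_{\lambda_1+\lambda_2}$. Orthogonality with respect to $\mathcal{L}_\lambda$ means $E[P_\lambda^j(Z_\lambda)P_\lambda^k(Z_\lambda)]=0$ for $j\ne k$. Multi-indices $\mathbf m=(m_1,\ldots,m_n)$ have non-negative integer entries, $|\mathbf m|=\sum_{i=1}^n m_i$, and $\boldsymbol\lambda=(\lambda_1,\ldots,\lambda_n)$. For $0\le k\le m$, $$\alpha_\lambda^{(k)}=\frac1{k!}E\big[Z_\lambda^kP_\lambda^k(Z_\lambda)\big],\qquad \alpha_{\boldsymbol\lambda}^{(\mathbf m)}=\prod_{i=1}^n\alpha_{\lambda_i}^{(m_i)},\qquad P_{\boldsymbol\lambda}^{\mathbf m}(\mathbf x)=\prod_{i=1}^nP_{\lambda_i}^{m_i}(x_i).$$ $\mathcal{M}_\lambda^k$ is the set of random variables $X$ with $EX^j=EZ_\lambda^j$ for $0\le j\le 2k$. For $X\in\mathcal{M}^k_\lambda$, $X_\lambda^{(k)}$ denotes a random variable with the $X$-$P_\lambda^k$ biased distribution, i.e. the unique distribution such that $E\,P_\lambda^k(X)F(X)=\alpha_\lambda^{(k)}E\,F^{(k)}(X_\lambda^{(k)})$ for all $F\in\mathcal{F}^k(P_\lambda^k)$, where $\mathcal{F}^k(P_\lambda^k)$ is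 the set of functions $F:\mathbf{R}\to\mathbf{R}$ whose $k$-th derivative exists and is measurable and for which $E|P_\lambda^k(X)F(X)|<\infty$ (this distribution exists for $X\in\mathcal M_\lambda^k$). In the definition of $W_\lambda^{(m)}$, the variables $(X_i)_{\lambda_i}^{(k)}$ attached to different indices $i$ are independent, and $\mathbf I$ is independent of all of them.
   Formalization: In the definition of the X-P biased distribution, the identity E P(X)F(X) = α E F^(k)(X^(k)) is required only for those F in F^k for which E F^(k)(X^(k)) exists (F^(k)(X^(k)) integrable); for other F in F^k the right-hand side is undefined. *)

theory Defs
  imports "HOL-Probability.Probability" "HOL-Computational_Algebra.Polynomial"
begin

text \<open>
  A family of random variables \<open>Z\<^sub>\<lambda>\<close>, \<open>\<lambda> > 0\<close>, enters only through its laws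
  \<open>L \<lambda>\<close>, which are probability measures on the Borel sets of the reals; so
  the expectation of \<open>f(Z\<^sub>\<lambda>)\<close> is the integral of \<open>f\<close> with respect to \<open>L \<lambda>\<close>.
  The polynomial \<open>P\<^sub>\<lambda>\<^sup>k\<close> is \<open>P \<lambda> k\<close>. Values of \<open>L\<close> and \<open>P\<close> at \<open>\<lambda> \<le> 0\<close> are irrelevant.
\<close>

text \<open>\<open>A \<star> B\<close> is the law of the sum of independent variables with laws \<open>A\<close> and \<open>B\<close>.\<close>

definition closed_under_independent_addition :: "(real \<Rightarrow> real measure) \<Rightarrow> bool" where
  "closed_under_independent_addition L \<longleftrightarrow>
     (\<forall>a > 0. \<forall>b > 0. (L a \<star> L b) = L (a + b))"

definition orthogonal_polynomial_system ::
  "real measure \<Rightarrow> nat \<Rightarrow> (nat \<Rightarrow> real poly) \<Rightarrow> bool" where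
  "orthogonal_polynomial_system Z m p \<longleftrightarrow>
     (\<forall>k\<le>m. lead_coeff (p k) = 1 \<and> degree (p k) = k) \<and>
     (\<forall>j\<le>m. \<forall>k\<le>m. j \<noteq> k \<longrightarrow> (\<integral>z. poly (p j) z * poly (p k) z \<partial>Z) = 0) \<and>
     (\<forall>k\<le>m. (\<integral>z. (poly (p k) z)\<^sup>2 \<partial>Z) > 0)"

text \<open>
  The indices \<open>i\<close> range over \<open>{1..n}\<close>. A multi-index is an extensional function on
  \<open>{1..n}\<close>, so that distinct functions are distinct multi-indices and the set below is finite.
\<close>

definition multi_indices :: "nat \<Rightarrow> nat \<Rightarrow> (nat \<Rightarrow> nat) set" where
  "multi_indices n m = {\<mu> \<in> {1..n} \<rightarrow>\<^sub>E UNIV. (\<Sum>i\<in>{1..n}. \<mu> i) = m}"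

definition alpha :: "(real \<Rightarrow> real measure) \<Rightarrow> (real \<Rightarrow> nat \<Rightarrow> real poly) \<Rightarrow> real \<Rightarrow> nat \<Rightarrow> real" where
  "alpha L P l k = 1 / fact k * (\<integral>z. z ^ k * poly (P l k) z \<partial>L l)"

definition multi_alpha ::
  "(real \<Rightarrow> real measure) \<Rightarrow> (real \<Rightarrow> nat \<Rightarrow> real poly) \<Rightarrow> nat \<Rightarrow> (nat \<Rightarrow> real) \<Rightarrow> (nat \<Rightarrow> nat) \<Rightarrow> real"
where
  "multi_alpha L P n ls \<mu> = (\<Prod>i\<in>{1..n}. alpha L P (ls i) (\<mu> i))"

definition multi_poly ::
  "(real \<Rightarrow> nat \<Rightarrow> real poly) \<Rightarrow> nat \<Rightarrow> (nat \<Rightarrow> real) \<Rightarrow> (nat \<Rightarrow> nat) \<Rightarrow> (nat \<Rightarrow> real) \<Rightarrow> real"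
where
  "multi_poly P n ls \<mu> x = (\<Prod>i\<in>{1..n}. poly (P (ls i) (\<mu> i)) (x i))"

text \<open>
  The random variables on \<open>M\<close> whose first \<open>2k\<close> moments agree with those of the law \<open>Z\<close>.
  Integrability is required explicitly, as the Bochner integral of a
  non-integrable function is 0 by convention.
\<close>

definition moment_class :: "real measure \<Rightarrow> nat \<Rightarrow> 'a measure \<Rightarrow> ('a \<Rightarrow> real) set" where
  "moment_class Z k M = {X \<in> borel_measurable M.
     \<forall>j\<le>2 * k. integrable M (\<lambda>\<omega>. X \<omega> ^ j) \<and> (\<integral>\<omega>. X \<omega> ^ j \<partial>M) = (\<integral>z. z ^ j \<partial>Z)}"

text \<open>The class \<open>\<F>\<^sup>k(p)\<close> of test functions, for the variable \<open>X\<close> on \<open>M\<close>.\<close>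

definition test_functions :: "nat \<Rightarrow> real poly \<Rightarrow> 'a measure \<Rightarrow> ('a \<Rightarrow> real) \<Rightarrow> (real \<Rightarrow> real) set" where
  "test_functions k p M X = {F.
     (\<forall>j<k. \<forall>x. (deriv ^^ j) F field_differentiable at x) \<and>
     (deriv ^^ k) F \<in> borel_measurable borel \<and>
     integrable M (\<lambda>\<omega>. poly p (X \<omega>) * F (X \<omega>))}"

text \<open>
  \<open>Y\<close> (on the probability space \<open>N\<close>) has the \<open>X\<close>-\<open>P\<^sub>l\<^sup>k\<close> biased distribution, where \<open>X\<close>
  lives on \<open>M\<close>. This is a property of the laws of \<open>X\<close> and \<open>Y\<close>, and the
  identity determines the law of \<open>Y\<close>.

  The identity is demanded for those test functions for which the expectation of
  \<open>F\<^sup>(\<^sup>k\<^sup>)(Y)\<close> exists. An everywhere existing derivative need not be Lebesgue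
  integrable: if \<open>X\<close> is uniform on \<open>{-1, 1}\<close>, \<open>p = x\<close> and \<open>k = 1\<close>, then \<open>Y\<close> is uniform on
  \<open>[-1, 1]\<close>, and \<open>F\<close> with \<open>F(x) = x\<^sup>2 sin(1/x\<^sup>2)\<close> for \<open>x > 0\<close> and \<open>F(x) = 0\<close> for \<open>x \<le> 0\<close> is a
  test function for which \<open>F'(Y)\<close> is not integrable. Without the proviso
  (and with a non-integrable function having integral 0) no \<open>Y\<close> would qualify.
\<close>

definition has_biased_distribution ::
  "(real \<Rightarrow> real measure) \<Rightarrow> (real \<Rightarrow> nat \<Rightarrow> real poly) \<Rightarrow> real \<Rightarrow> nat \<Rightarrow>
    'a measure \<Rightarrow> ('a \<Rightarrow> real) \<Rightarrow> 'b measure \<Rightarrow> ('b \<Rightarrow> real) \<Rightarrow> bool"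
where
  "has_biased_distribution L P l k M X N Y \<longleftrightarrow>
     X \<in> moment_class (L l) k M \<and>
     Y \<in> borel_measurable N \<and>
     (\<forall>F \<in> test_functions k (P l k) M X.
        integrable N (\<lambda>\<omega>. (deriv ^^ k) F (Y \<omega>)) \<longrightarrow>
        (\<integral>\<omega>. poly (P l k) (X \<omega>) * F (X \<omega>) \<partial>M) =
          alpha L P l k * (\<integral>\<omega>. (deriv ^^ k) F (Y \<omega>) \<partial>N))"

text \<open>
  Independence of two random variables with values in spaces \<open>A\<close>, \<open>B\<close> of possibly different
  types (the library's \<open>indep_var\<close> requires equal types).
\<close>

definition indep_pair ::
  "'a measure \<Rightarrow> 'b measure \<Rightarrow> ('a \<Rightarrow> 'b) \<Rightarrow> 'c measure \<Rightarrow> ('a \<Rightarrow> 'c) \<Rightarrow> bool" where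
  "indep_pair M A U B V \<longleftrightarrow>
     U \<in> measurable M A \<and> V \<in> measurable M B \<and>
     prob_space.indep_set M
       {U -` S \<inter> space M | S. S \<in> sets A} {V -` T \<inter> space M | T. T \<in> sets B}"

end

theory Submission
  imports Defs
begin

text \<open>
  The bias identity is multiplicative on the Fourier side. Testing it against
  \<open>cos (t x + \<theta>)\<close> for all phases \<open>\<theta>\<close> shows that a variable \<open>Y\<close> with the \<open>X\<close>-\<open>p\<close> biased
  distribution of order \<open>k\<close> satisfies
  \<open>E (p(X) exp(i t X)) = \<alpha> (i t)\<^sup>k E (exp(i t Y))\<close>. For independent \<open>X\<^sub>i\<close> these
  relations can be multiplied: inserting the addition identity for \<open>P\<^sub>\<lambda>\<^sup>m\<close> into
  \<open>E (P\<^sub>\<lambda>\<^sup>m(W) exp(i t W))\<close> produces, in the term of a multi-index \<open>\<mu>\<close> with \<open>|\<mu>| = m\<close>, the factor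
  \<open>c\<^sub>\<mu> \<alpha>\<^sub>\<mu> (i t)\<^sup>m\<close> times the characteristic function of the sum of the biased variables of
  orders \<open>\<mu>\<^sub>i\<close>. Since \<open>c\<^sub>\<mu> \<alpha>\<^sub>\<mu> / \<alpha>\<^sub>\<lambda>\<close> is the probability of \<open>I = \<mu>\<close>, the total is
  \<open>\<alpha>\<^sub>\<lambda> (i t)\<^sup>m\<close> times the characteristic function of the randomly indexed sum
  (\<open>iexp_expectation_of_sum\<close>, \<open>mixture_iexp\<close>).

  The analytic core is the way back, from this Fourier relation to the bias identity for every
  test function (\<open>biased_identity_of_iexp_identity\<close>). A density argument is delicate here, because
  \<open>F\<^sup>(\<^sup>m\<^sup>)\<close> is only a pointwise derivative: it is gauge integrable on compact intervals, but possibly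
  not Lebesgue integrable. Interpolation avoids the difficulty. Orthogonality forces \<open>p = P\<^sub>\<lambda>\<^sup>m\<close> to
  have \<open>m\<close> distinct real roots (\<open>orthogonal_poly_simple_roots\<close>). If \<open>H\<close> is the polynomial of degree
  less than \<open>m\<close> that interpolates \<open>F\<close> at these roots, Peano's formula reads \<open>F(w) - H(w) = \<integral> K(w,y) F\<^sup>(\<^sup>m\<^sup>)(y) dy\<close>, and the kernel satisfies
  \<open>p(w) K(w,y) \<ge> 0\<close> (\<open>peano_kernel_has_integral\<close>, \<open>peano_kernel_nonneg\<close>). As \<open>p\<close> is orthogonal to
  \<open>H\<close>, Fubini's theorem gives \<open>E (p(W) F(W)) = \<integral> q(y) F\<^sup>(\<^sup>m\<^sup>)(y) dy\<close> with
  \<open>q(y) = E (p(W) K(W,y)) \<ge> 0\<close>; by the sign of the kernel, integrability of \<open>q F\<^sup>(\<^sup>m\<^sup>)\<close> is all that is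
  required. So \<open>q/\<alpha>\<close> is the density of a law that fulfils the bias identity. Any other law with the
  same Fourier relation has the same characteristic function, hence equals it by Levy's
  uniqueness theorem.

  The statements about the weights come from evaluating \<open>E (P\<^sub>\<lambda>\<^sup>m(W) P\<^sup>\<nu>(Z))\<close> in two ways, for
  independent \<open>Z\<^sub>i\<close> from the family with sum \<open>W\<close>. Expanding powers of \<open>W\<close> into monomials gives
  \<open>m! \<alpha>\<^sub>\<nu>\<close>, since \<open>P\<^sup>\<nu>\<close> annihilates every monomial of degree at most \<open>m\<close> except \<open>z\<^sup>\<nu>\<close>; the addition
  identity gives \<open>c\<^sub>\<nu> \<nu>! \<alpha>\<^sub>\<nu>\<close>. Hence \<open>c\<^sub>\<nu> = m!/\<nu>!\<close> is positive, and weighting the first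
  evaluation by \<open>c\<^sub>\<nu>\<close> and summing yields \<open>E (P\<^sub>\<lambda>\<^sup>m(W)\<^sup>2) = m! \<alpha>\<^sub>\<lambda>\<close> on one side and
  \<open>m! \<Sum> c\<^sub>\<nu> \<alpha>\<^sub>\<nu>\<close> on the other.
\<close>

section \<open>The sign of an interpolation error\<close>

text \<open>
  Rolle's theorem in each gap between neighbouring zeros; the bound by \<open>Max A\<close> makes the zeros of
  different gaps distinct when the largest zero is added last.
\<close>

lemma rolle_step:
  fixes f f' :: "real \<Rightarrow> real"
  assumes "finite A" "A \<noteq> {}" "\<And>x. x \<in> A \<Longrightarrow> f x = 0"
    and der: "\<And>x. (f has_real_derivative f' x) (at x)"
  shows "\<exists>B. finite B \<and> Suc (card B) = card A \<and> (\<forall>b\<in>B. f' b = 0 \<and> b < Max A)"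
  using assms(1-3)
proof (induction A rule: finite_linorder_max_induct)
  case empty
  then show ?case by simp
next
  case (insert b A)
  show ?case
  proof (cases "A = {}")
    case True
    then show ?thesis by (intro exI[of _ "{}"]) auto
  next
    case False
    then obtain B where B: "finite B" "Suc (card B) = card A" "\<forall>x\<in>B. f' x = 0 \<and> x < Max A"
      using insert by auto
    have ab: "Max A < b" using False insert.hyps by auto
    have "f (Max A) = f b" using insert.prems False insert.hyps(1) by simp
    then obtain z where z: "Max A < z" "z < b" "DERIV f z :> 0"
      using Rolle[OF ab, of f] der
      by (metis DERIV_continuous_on DERIV_subset has_field_derivative_at_within
          real_differentiable_def)
    have "f' z = 0" using z(3) der DERIV_unique by blast
    moreover have "Max (insert b A) = b"
      using insert.hyps False by (intro Max_eqI) auto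
    moreover have "z \<notin> B" using B(3) z(1) by auto
    moreover have "b \<notin> A" using insert.hyps by auto
    ultimately show ?thesis using B z ab insert.hyps(1)
      by (intro exI[of _ "insert z B"]) auto
  qed
qed

lemma rolle_iterated:
  fixes f :: "nat \<Rightarrow> real \<Rightarrow> real"
  assumes der: "\<And>j x. j < k \<Longrightarrow> (f j has_real_derivative f (Suc j) x) (at x)"
    and "finite A" "card A = k + Suc s" "\<And>x. x \<in> A \<Longrightarrow> f 0 x = 0"
  shows "\<exists>B. finite B \<and> card B = Suc s \<and> (\<forall>b\<in>B. f k b = 0)"
  using assms
proof (induction k arbitrary: f A)
  case 0
  then show ?case by auto
next
  case (Suc k)
  obtain B where B: "finite B" "Suc (card B) = card A" "\<forall>b\<in>B. f 1 b = 0"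
    using rolle_step[of A "f 0" "f 1"] Suc.prems by fastforce
  have "\<exists>B'. finite B' \<and> card B' = Suc s \<and> (\<forall>b\<in>B'. (\<lambda>j. f (Suc j)) k b = 0)"
    by (rule Suc.IH[of "\<lambda>j. f (Suc j)" B]) (use B Suc.prems in auto)
  then show ?case by simp
qed

text \<open>
  This is \<open>(x - y)\<^sub>+\<^sup>m\<^sup>-\<^sup>1 / (m - 1)!\<close>, where for \<open>m = 1\<close> the power of the positive part is read as the
  indicator of \<open>y < x\<close>.
\<close>

definition truncated_power :: "nat \<Rightarrow> real \<Rightarrow> real \<Rightarrow> real" where
  "truncated_power m y x = (if y < x then (x - y) ^ (m - 1) / fact (m - 1) else 0)"

text \<open>
  For \<open>m = 2\<close> there is a kink at \<open>x = y\<close>; from \<open>m = 3\<close> on the function is flat enough at \<open>y\<close>.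
\<close>

lemma has_real_derivative_truncated_power:
  assumes "m \<ge> 3"
  shows "(truncated_power m y has_real_derivative truncated_power (m - 1) y x) (at x)"
proof -
  obtain k where m: "m = k + 3" using assms by (metis le_add_diff_inverse2)
  consider "x < y" | "x > y" | "x = y" by linarith
  then show ?thesis
  proof cases
    case 1
    have "((\<lambda>_. 0) has_real_derivative truncated_power (m - 1) y x) (at x)"
      using 1 by (simp add: truncated_power_def)
    then show ?thesis
      by (rule has_field_derivative_transform_within_open[where S = "{..<y}"])
        (use 1 in \<open>auto simp: truncated_power_def\<close>)
  next
    case 2
    have e: "fact (k+2) = real (k+2) * fact (k+1)" by simp
    have "((\<lambda>x. (x - y) ^ (k+2) / fact (k+2)) has_real_derivative
            (real (k+2) * (x - y) ^ (k+1) / fact (k+2))) (at x)"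
      by (auto intro!: derivative_eq_intros simp del: power_Suc fact_Suc)
    also have "real (k+2) * (x - y) ^ (k+1) / fact (k+2) = (x - y) ^ (k+1) / fact (k+1)"
      unfolding e by (rule mult_divide_mult_cancel_left) simp
    finally have "((\<lambda>x. (x - y) ^ (k+2) / fact (k+2)) has_real_derivative
           truncated_power (m - 1) y x) (at x)" using 2 by (simp add: truncated_power_def m del: power_Suc fact_Suc)
    then show ?thesis
      by (rule has_field_derivative_transform_within_open[where S = "{y<..}"])
        (use 2 in \<open>auto simp: truncated_power_def m simp del: power_Suc fact_Suc\<close>)
  next
    case 3
    have "((\<lambda>h. (truncated_power m y (y + h) - truncated_power m y y) / h) \<longlongrightarrow> 0) (at 0)"
    proof (rule Lim_null_comparison)
      show "\<forall>\<^sub>F h in at 0. norm ((truncated_power m y (y + h) - truncated_power m y y) / h)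
              \<le> \<bar>h\<bar> ^ (k+1)"
      proof (rule always_eventually, rule allI)
        fix h :: real
        have "h ^ (k+2) / (fact (k+2) * h) \<le> h ^ (k+1)" if "h > 0"
        proof -
          have "h ^ (k+2) / (fact (k+2) * h) = h ^ (k+1) / fact (k+2)"
            using that power_Suc2[of h "k + 1"] by (simp del: power_Suc fact_Suc)
          also have "\<dots> \<le> h ^ (k+1) / 1"
            using that by (intro divide_left_mono) (auto simp del: fact_Suc)
          finally show ?thesis by simp
        qed
        then show "norm ((truncated_power m y (y + h) - truncated_power m y y) / h) \<le> \<bar>h\<bar> ^ (k+1)"
          by (auto simp: truncated_power_def m simp del: power_Suc fact_Suc)
      qed
      show "((\<lambda>h::real. \<bar>h\<bar> ^ (k+1)) \<longlongrightarrow> 0) (at 0)" by (auto intro!: tendsto_eq_intros)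
    qed
    then show ?thesis using 3 by (simp add: DERIV_def truncated_power_def)
  qed
qed

text \<open>
  The function is strictly convex, so it is negative between two of its zeros.
\<close>

lemma strictly_convex_no_three_zeros:
  fixes a b c y A B D :: real
  defines "g \<equiv> \<lambda>x. max 0 (x - y) - (A + B * x + D * x\<^sup>2)"
  assumes "D < 0" "a < b" "b < c"
  shows "\<not> (g a = 0 \<and> g b = 0 \<and> g c = 0)"
proof
  assume z: "g a = 0 \<and> g b = 0 \<and> g c = 0"
  define t where "t = (b - a) / (c - a)"
  have t: "0 < t" "t < 1" using assms by (auto simp: t_def field_simps)
  have "t * (c - a) = b - a" using assms by (simp add: t_def)
  then have b: "b = (1 - t) * a + t * c" by (simp add: algebra_simps)
  have "(1 - t) * (a - y) \<le> (1 - t) * max 0 (a - y)" "t * (c - y) \<le> t * max 0 (c - y)"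
    using t by (auto intro!: mult_left_mono)
  moreover have "0 \<le> (1 - t) * max 0 (a - y)" "0 \<le> t * max 0 (c - y)" using t by auto
  moreover have "b - y = (1 - t) * (a - y) + t * (c - y)" by (simp add: b algebra_simps)
  ultimately have "max 0 (b - y) \<le> (1 - t) * max 0 (a - y) + t * max 0 (c - y)" by auto
  moreover have "(1 - t) * (A + B * a + D * a\<^sup>2) + t * (A + B * c + D * c\<^sup>2)
      - (A + B * b + D * b\<^sup>2) = D * (t * (1 - t) * (c - a)\<^sup>2)"
    unfolding b by (simp add: algebra_simps power2_eq_square)
  moreover have "D * (t * (1 - t) * (c - a)\<^sup>2) < 0"
    using t assms by (intro mult_neg_pos) auto
  moreover have "max 0 (a - y) = A + B * a + D * a\<^sup>2" "max 0 (b - y) = A + B * b + D * b\<^sup>2"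
    "max 0 (c - y) = A + B * c + D * c\<^sup>2"
    using z by (auto simp: g_def)
  ultimately show False by auto
qed

lemma degree_node_poly:
  fixes S :: "real set"
  assumes "finite S"
  shows "degree (\<Prod>r\<in>S. [:- r, 1:]) = card S" "lead_coeff (\<Prod>r\<in>S. [:- r, 1:]) = 1"
proof -
  show "lead_coeff (\<Prod>r\<in>S. [:- r, 1:]) = 1"
    by (simp add: lead_coeff_prod)
  show "degree (\<Prod>r\<in>S. [:- r, 1:]) = card S"
    by (subst degree_prod_eq_sum_degree) auto
qed

lemma higher_pderiv_quadratic:
  fixes G :: "real poly"
  assumes "degree G = k + 2"
  shows "\<exists>A B D. sgn D = sgn (lead_coeff G) \<and> (\<forall>x. poly ((pderiv ^^ k) G) x = A + B * x + D * x\<^sup>2)"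
proof -
  define Q where "Q = (pderiv ^^ k) G"
  have dQ: "degree Q = 2" unfolding Q_def degree_higher_pderiv by (simp add: assms)
  have "coeff Q 2 = pochhammer (of_nat (Suc 2)) k * coeff G (2 + k)"
    unfolding Q_def coeff_higher_pderiv by (simp add: add.commute)
  moreover have "pochhammer (real (Suc 2)) k > 0" by (intro pochhammer_pos) auto
  ultimately have "sgn (coeff Q 2) = sgn (lead_coeff G)"
    using assms by (simp add: sgn_mult add.commute)
  moreover have "poly Q x = coeff Q 0 + coeff Q 1 * x + coeff Q 2 * x\<^sup>2" for x
    by (simp add: poly_altdef dQ eval_nat_numeral)
  ultimately show ?thesis unfolding Q_def by blast
qed

text \<open>
  If the sign were wrong, some \<open>G = H + C p\<close> with \<open>C < 0\<close> would agree with the truncated power at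
  the \<open>m\<close> nodes and at \<open>w\<close>. Differentiating the difference \<open>m - 2\<close> times leaves three zeros, by
  Rolle, of a function that is strictly convex: \<open>max 0 (x - y)\<close> minus a quadratic polynomial with
  negative leading coefficient. For \<open>m = 1\<close> a nondecreasing step function would
  agree with a strictly decreasing line at two points.
\<close>

lemma truncated_power_interpolation_error_sign:
  fixes S :: "real set" and H :: "real poly"
  assumes S: "finite S" "card S = m" "m \<ge> 1"
    and H: "degree H < m" "\<And>r. r \<in> S \<Longrightarrow> poly H r = truncated_power m y r"
  shows "0 \<le> poly (\<Prod>r\<in>S. [:- r, 1:]) w * (truncated_power m y w - poly H w)"
proof (rule ccontr)
  define p where "p = (\<Prod>r\<in>S. [:- r, 1:])"
  assume neg: "\<not> ?thesis"
  have pr: "poly p r = 0 \<longleftrightarrow> r \<in> S" for r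
    using S by (auto simp: p_def poly_prod)
  have dp: "degree p = m" "lead_coeff p = 1"
    using degree_node_poly[OF S(1)] S(2) by (auto simp: p_def)
  have pw: "poly p w \<noteq> 0" "w \<notin> S" using neg pr[of w] by (auto simp: p_def)
  define C where "C = (truncated_power m y w - poly H w) / poly p w"
  have C: "C < 0"
    using neg pw(1) unfolding C_def p_def[symmetric]
    by (auto simp: divide_less_0_iff mult_less_0_iff not_le)
  define G where "G = H + smult C p"
  have dG: "degree G = m" "lead_coeff G = C"
  proof -
    have "degree (smult C p) = m" using C dp by simp
    then show 1: "degree G = m" unfolding G_def using H(1) by (simp add: degree_add_eq_right)
    show "lead_coeff G = C" unfolding 1 using dp H(1) by (simp add: G_def coeff_eq_0)
  qed
  have Gz: "poly G r = truncated_power m y r" if "r \<in> insert w S" for r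
    using that pr[of r] H(2)[of r] pw by (auto simp: G_def C_def)
  consider "m = 1" | "m \<ge> 2" using S(3) by linarith
  then show False
  proof cases
    case 1
    then obtain r where r: "S = {r}" using S(2) card_1_singletonE by metis
    obtain c0 c1 where G: "G = [:c0, c1:]" using dG(1) 1 degree1_coeffs by blast
    then have c1: "c1 < 0" using dG 1 C by (cases "c1 = 0") auto
    have eqs: "c0 + w * c1 = truncated_power 1 y w" "c0 + r * c1 = truncated_power 1 y r"
      using Gz[of w] Gz[of r] 1 by (auto simp: G r)
    have "w \<noteq> r" using pw r by auto
    then consider "w < r" | "r < w" by linarith
    then show False
    proof cases
      case 1
      then have "r * c1 < w * c1" using c1 by simp
      then show False using eqs 1 by (auto simp: truncated_power_def split: if_splits)
    next
      case 2
      then have "w * c1 < r * c1" using c1 by simp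
      then show False using eqs 2 by (auto simp: truncated_power_def split: if_splits)
    qed
  next
    case 2
    define k where "k = m - 2"
    have mk: "m = k + 2" using 2 by (simp add: k_def)
    define f where "f j x = truncated_power (m - j) y x - poly ((pderiv ^^ j) G) x" for j x
    have "\<exists>B. finite B \<and> card B = Suc 2 \<and> (\<forall>b\<in>B. f k b = 0)"
    proof (rule rolle_iterated[where A = "insert w S"])
      fix j x assume "j < k"
      then show "(f j has_real_derivative f (Suc j) x) (at x)"
        unfolding f_def using has_real_derivative_truncated_power[of "m - j" y x]
        by (auto intro!: derivative_eq_intros simp: mk)
    qed (use S pw Gz mk in \<open>auto simp: f_def\<close>)
    then obtain B where B: "card B = 3" "\<forall>b\<in>B. f k b = 0" by (auto simp: eval_nat_numeral)
    obtain b1 b2 b3 where b: "B = {b1, b2, b3}" "b1 \<noteq> b2" "b1 \<noteq> b3" "b2 \<noteq> b3"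
      using B(1) by (auto simp: card_3_iff)
    obtain a b c where abc: "a < b" "b < c" "f k a = 0" "f k b = 0" "f k c = 0"
      using b B(2) by (metis insertCI linorder_neqE_linordered_idom)
    obtain A1 B1 D where D: "sgn D = sgn C"
      "\<And>x. poly ((pderiv ^^ k) G) x = A1 + B1 * x + D * x\<^sup>2"
      using higher_pderiv_quadratic[of G k] dG mk by auto
    have fk: "f k x = max 0 (x - y) - (A1 + B1 * x + D * x\<^sup>2)" for x
      by (auto simp: f_def D(2) mk truncated_power_def)
    have "D < 0" using D(1) C by (metis sgn_less)
    then show False using strictly_convex_no_three_zeros[of D a b c y A1 B1] abc by (simp add: fk)
  qed
qed

section \<open>The Peano kernel of Lagrange interpolation\<close>

lemma borel_measurable_poly [measurable (raw)]:
  fixes p :: "real poly"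
  assumes "f \<in> borel_measurable M"
  shows "(\<lambda>x. poly p (f x)) \<in> borel_measurable M"
  using borel_measurable_continuous_on[OF _ assms, of "poly p"]
  by (simp add: continuous_intros)

definition lagrange_basis :: "real set \<Rightarrow> real \<Rightarrow> real poly" where
  "lagrange_basis S r = (\<Prod>s\<in>S - {r}. smult (1 / (r - s)) [:- s, 1:])"

lemma degree_lagrange_basis:
  assumes "finite S" "r \<in> S"
  shows "degree (lagrange_basis S r) < card S"
proof -
  have "degree (lagrange_basis S r) \<le> (\<Sum>s\<in>S - {r}. degree (smult (1 / (r - s)) [:- s, 1:]))"
    unfolding lagrange_basis_def
    using degree_prod_sum_le[of "S - {r}" "\<lambda>s. smult (1 / (r - s)) [:- s, 1:]"] assms
    by (simp add: comp_def)
  also have "\<dots> \<le> (\<Sum>s\<in>S - {r}. 1)"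
    by (intro sum_mono) simp
  also have "\<dots> < card S"
    using assms card_Diff1_less[of S r] by simp
  finally show ?thesis .
qed

lemma poly_lagrange_basis:
  assumes "finite S" "s \<in> S"
  shows "poly (lagrange_basis S r) s = (if s = r then 1 else 0)"
proof (cases "s = r")
  case True
  then show ?thesis by (simp add: lagrange_basis_def poly_prod divide_simps)
next
  case False
  then show ?thesis
    using assms by (auto simp: lagrange_basis_def poly_prod intro!: bexI[of _ s])
qed

lemma lagrange_interpolation:
  assumes "finite S" "degree H < card S"
  shows "poly H x = (\<Sum>r\<in>S. poly H r * poly (lagrange_basis S r) x)"
proof -
  have "H = (\<Sum>r\<in>S. smult (poly H r) (lagrange_basis S r))"
  proof (rule poly_eqI_degree[where A = S])
    fix s assume s: "s \<in> S"
    have "(\<Sum>r\<in>S. poly H r * poly (lagrange_basis S r) s) = (\<Sum>r\<in>S. if s = r then poly H r else 0)"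
      by (intro sum.cong) (use poly_lagrange_basis[OF assms(1) s] in auto)
    also have "\<dots> = poly H s" using s assms(1) by simp
    finally show "poly H s = poly (\<Sum>r\<in>S. smult (poly H r) (lagrange_basis S r)) s"
      by (simp add: poly_sum)
  next
    show "degree (\<Sum>r\<in>S. smult (poly H r) (lagrange_basis S r)) < card S"
      using assms degree_lagrange_basis[OF assms(1)]
      by (intro degree_sum_less) (auto intro: le_less_trans[OF degree_smult_le])
  qed fact
  then have "poly H x = poly (\<Sum>r\<in>S. smult (poly H r) (lagrange_basis S r)) x" by simp
  then show ?thesis by (simp add: poly_sum)
qed

text \<open>
  The error at \<open>w\<close> when the function \<open>truncated_power (card S) y\<close> is interpolated at the nodes
  \<open>S\<close>.
\<close>

definition peano_kernel :: "real set \<Rightarrow> real \<Rightarrow> real \<Rightarrow> real" where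
  "peano_kernel S w y = truncated_power (card S) y w
     - (\<Sum>r\<in>S. truncated_power (card S) y r * poly (lagrange_basis S r) w)"

lemma borel_measurable_peano_kernel [measurable (raw)]:
  assumes [measurable]: "f \<in> borel_measurable M" "g \<in> borel_measurable M"
  shows "(\<lambda>x. peano_kernel S (f x) (g x)) \<in> borel_measurable M"
  unfolding peano_kernel_def truncated_power_def by measurable

lemma peano_kernel_nonneg:
  assumes "finite S" "S \<noteq> {}"
  shows "0 \<le> poly (\<Prod>r\<in>S. [:- r, 1:]) w * peano_kernel S w y"
proof -
  define H where "H = (\<Sum>r\<in>S. smult (truncated_power (card S) y r) (lagrange_basis S r))"
  have c: "card S \<ge> 1" using assms by (simp add: Suc_le_eq card_gt_0_iff)
  have "degree H < card S" unfolding H_def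
    using degree_lagrange_basis[OF assms(1)] c
    by (intro degree_sum_less) (auto intro: le_less_trans[OF degree_smult_le])
  moreover have "poly H s = truncated_power (card S) y s" if s: "s \<in> S" for s
  proof -
    have "poly H s = (\<Sum>r\<in>S. if s = r then truncated_power (card S) y r else 0)"
      unfolding H_def poly_sum poly_smult
      by (intro sum.cong) (use poly_lagrange_basis[OF assms(1) s] in auto)
    then show ?thesis using s assms(1) by simp
  qed
  ultimately show ?thesis
    using truncated_power_interpolation_error_sign[OF assms(1) refl c, of H y w]
    by (simp add: peano_kernel_def H_def poly_sum)
qed

text \<open>
  With a gauge integral, Taylor's formula with integral remainder holds as soon as the highest
  derivative exists everywhere. The truncation makes the domain of
  integration independent of \<open>x\<close>, so that the formulas for several \<open>x\<close> can be combined linearly.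
\<close>

lemma taylor_truncated_power:
  fixes D :: "nat \<Rightarrow> real \<Rightarrow> real"
  assumes m: "m \<ge> 1" and x: "a \<le> x" "x \<le> b"
    and der: "\<And>j x. j < m \<Longrightarrow> (D j has_real_derivative D (Suc j) x) (at x)"
  shows "((\<lambda>y. truncated_power m y x * D m y) has_integral
           D 0 x - (\<Sum>i<m. (x - a) ^ i / fact i * D i a)) {a..b}"
proof -
  define g where "g = (\<lambda>y. ((x - y) ^ (m - 1) / fact (m - 1)) *\<^sub>R D m y)"
  define I where "I = D 0 x - (\<Sum>i<m. ((x - a) ^ i / fact i) *\<^sub>R D i a)"
  have "(g has_integral I) {a..x}"
    unfolding g_def I_def
  proof (rule Taylor_has_integral)
    fix i t assume "i < m" "a \<le> t" "t \<le> x"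
    then show "(D i has_vector_derivative D (Suc i) t) (at t within {a..x})"
      using der by (simp add: has_real_derivative_iff_has_vector_derivative[symmetric]
          has_field_derivative_at_within)
  qed (use m x in auto)
  then have "((\<lambda>y. if y \<in> {a..x} then g y else 0) has_integral I) {a..b}"
    by (subst has_integral_restrict) (use x in auto)
  \<comment> \<open>For \<open>m = 1\<close> the integrands differ at \<open>y = x\<close>, where \<open>(x - y)\<^sup>0 = 1\<close>.\<close>
  then have "((\<lambda>y. truncated_power m y x * D m y) has_integral I) {a..b}"
    by (rule has_integral_spike_finite[rotated 2, where S = "{x}"])
      (auto simp: truncated_power_def g_def)
  then show ?thesis by (simp add: I_def)
qed

text \<open>
  Interpolation reproduces the Taylor polynomial of degree below \<open>card S\<close>, so in the interpolation
  error only the remainder terms survive. The kernel vanishes outside the convex hull of \<open>w\<close> and the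
  nodes: to the right all truncated powers are zero, to the left they are, on the hull, polynomials
  of degree below \<open>card S\<close> and are reproduced exactly.
\<close>

lemma peano_kernel_has_integral:
  fixes D :: "nat \<Rightarrow> real \<Rightarrow> real"
  assumes S: "finite S" "S \<noteq> {}"
    and der: "\<And>j x. j < card S \<Longrightarrow> (D j has_real_derivative D (Suc j) x) (at x)"
  shows "((\<lambda>y. peano_kernel S w y * D (card S) y) has_integral
           D 0 w - (\<Sum>r\<in>S. D 0 r * poly (lagrange_basis S r) w)) UNIV"
proof -
  define m where "m = card S"
  have m: "m \<ge> 1" using S by (simp add: m_def Suc_le_eq card_gt_0_iff)
  define a where "a = Min (insert w S)"
  define b where "b = Max (insert w S)"
  have ab: "a \<le> x" "x \<le> b" if "x \<in> insert w S" for x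
    using that S Min_le[of "insert w S" x] Max_ge[of "insert w S" x] by (auto simp: a_def b_def)
  define T where "T = (\<Sum>i<m. smult (D i a / fact i) ([:- a, 1:] ^ i))"
  have T: "poly T x = (\<Sum>i<m. (x - a) ^ i / fact i * D i a)" for x
    by (simp add: T_def poly_sum poly_power mult.commute)
  have "degree T < m" unfolding T_def
    using m by (intro degree_sum_less)
      (auto intro!: le_less_trans[OF degree_smult_le] simp: degree_linear_power)
  then have Tw: "poly T w = (\<Sum>r\<in>S. poly T r * poly (lagrange_basis S r) w)"
    using lagrange_interpolation[OF S(1), of T w] by (simp add: m_def)
  have tp: "((\<lambda>y. truncated_power m y x * D m y) has_integral D 0 x - poly T x) {a..b}"
    if "x \<in> insert w S" for x
    unfolding T using taylor_truncated_power[OF m ab[OF that], of D] der by (simp add: m_def)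
  have "((\<lambda>y. truncated_power m y w * D m y -
        (\<Sum>r\<in>S. (truncated_power m y r * D m y) * poly (lagrange_basis S r) w)) has_integral
      (D 0 w - poly T w) - (\<Sum>r\<in>S. (D 0 r - poly T r) * poly (lagrange_basis S r) w)) {a..b}"
    using S tp by (intro has_integral_diff has_integral_sum has_integral_mult_left) auto
  also have "(D 0 w - poly T w) - (\<Sum>r\<in>S. (D 0 r - poly T r) * poly (lagrange_basis S r) w)
      = D 0 w - (\<Sum>r\<in>S. D 0 r * poly (lagrange_basis S r) w)"
    unfolding Tw by (simp add: algebra_simps sum_subtractf)
  also have "(\<lambda>y. truncated_power m y w * D m y -
        (\<Sum>r\<in>S. (truncated_power m y r * D m y) * poly (lagrange_basis S r) w))
      = (\<lambda>y. peano_kernel S w y * D (card S) y)"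
    by (simp add: fun_eq_iff peano_kernel_def m_def sum_distrib_left sum_distrib_right algebra_simps)
  finally show ?thesis
  proof (rule has_integral_on_superset)
    fix y assume "y \<notin> {a..b}"
    then consider "y < a" | "y > b" by force
    then show "peano_kernel S w y * D (card S) y = 0"
    proof cases
      case 1
      define H where "H = smult (1 / fact (m - 1)) ([:- y, 1:] ^ (m - 1))"
      have H: "truncated_power m y x = poly H x" if "x \<in> insert w S" for x
        using 1 ab[OF that] by (simp add: truncated_power_def H_def poly_power)
      have "degree H < m" using m
        by (auto simp: H_def degree_linear_power intro!: le_less_trans[OF degree_smult_le])
      then have "poly H w = (\<Sum>r\<in>S. poly H r * poly (lagrange_basis S r) w)"
        using lagrange_interpolation[OF S(1), of H w] by (simp add: m_def)
      then show ?thesis using H by (simp add: peano_kernel_def m_def)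
    next
      case 2
      then have "truncated_power m y x = 0" if "x \<in> insert w S" for x
        using ab[OF that] by (simp add: truncated_power_def)
      then show ?thesis by (simp add: peano_kernel_def m_def)
    qed
  qed auto
qed

section \<open>The biased density of a law with given orthogonal polynomial\<close>

lemma (in finite_measure) integrable_poly_moment:
  fixes X :: "'a \<Rightarrow> real"
  assumes [measurable]: "X \<in> borel_measurable M"
    and int: "integrable M (\<lambda>\<omega>. X \<omega> ^ (2 * m))" and deg: "degree p \<le> 2 * m"
  shows "integrable M (\<lambda>\<omega>. poly p (X \<omega>))"
proof -
  have pow: "integrable M (\<lambda>\<omega>. X \<omega> ^ j)" if "j \<le> 2 * m" for j
  proof (rule Bochner_Integration.integrable_bound)
    show "integrable M (\<lambda>\<omega>. 1 + X \<omega> ^ (2 * m))" using int by simp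
    have "\<bar>x\<bar> ^ j \<le> 1 + x ^ (2 * m)" for x :: real
    proof (cases "\<bar>x\<bar> \<le> 1")
      case True
      then have "\<bar>x\<bar> ^ j \<le> 1" by (simp add: power_le_one)
      then show ?thesis using zero_le_even_power'[of x m] by linarith
    next
      case False
      then have "\<bar>x\<bar> ^ j \<le> \<bar>x\<bar> ^ (2 * m)" using that by (intro power_increasing) auto
      then show ?thesis by (simp add: power_even_abs)
    qed
    then show "AE \<omega> in M. norm (X \<omega> ^ j) \<le> norm (1 + X \<omega> ^ (2 * m))"
      by (auto simp: power_abs intro!: AE_I2 order_trans[OF _ abs_ge_self])
  qed simp
  show ?thesis unfolding poly_altdef
    using deg by (intro Bochner_Integration.integrable_sum integrable_mult_right pow) auto
qed

lemma integral_mult_poly_eq_0: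
  fixes f X :: "'a \<Rightarrow> real"
  assumes int: "\<And>j. j < m \<Longrightarrow> integrable M (\<lambda>\<omega>. f \<omega> * X \<omega> ^ j)"
    and zero: "\<And>j. j < m \<Longrightarrow> (\<integral>\<omega>. f \<omega> * X \<omega> ^ j \<partial>M) = 0" and deg: "degree h < m"
  shows "(\<integral>\<omega>. f \<omega> * poly h (X \<omega>) \<partial>M) = 0"
proof -
  have "(\<integral>\<omega>. f \<omega> * poly h (X \<omega>) \<partial>M)
      = (\<integral>\<omega>. (\<Sum>j\<le>degree h. coeff h j * (f \<omega> * X \<omega> ^ j)) \<partial>M)"
    by (simp add: poly_altdef sum_distrib_left mult_ac)
  also have "\<dots> = (\<Sum>j\<le>degree h. coeff h j * (\<integral>\<omega>. f \<omega> * X \<omega> ^ j \<partial>M))"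
    using deg int by (subst Bochner_Integration.integral_sum) auto
  also have "\<dots> = 0" using deg zero by (intro sum.neutral) auto
  finally show ?thesis .
qed

text \<open>
  The orthogonal polynomial of degree \<open>card S\<close> of \<open>M\<close> enters through its set \<open>S\<close> of simple roots.
\<close>

locale orthogonal_node_law = real_distribution M for M :: "real measure" +
  fixes S :: "real set"
  assumes finite_nodes: "finite S" and nodes_nonempty: "S \<noteq> {}"
    and moment: "integrable M (\<lambda>x. x ^ (2 * card S))"
    and orthogonal: "\<And>j. j < card S \<Longrightarrow> (\<integral>x. poly (\<Prod>r\<in>S. [:- r, 1:]) x * x ^ j \<partial>M) = 0"
begin

abbreviation node_poly :: "real poly" where
  "node_poly \<equiv> \<Prod>r\<in>S. [:- r, 1:]"

text \<open>
  The density is not normalised: its total mass is the factor \<open>\<alpha>\<close> of the bias identity.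
\<close>

definition biased_density :: "real \<Rightarrow> real" where
  "biased_density y = (\<integral>w. poly node_poly w * peano_kernel S w y \<partial>M)"

lemma integrable_poly: "degree h \<le> 2 * card S \<Longrightarrow> integrable M (poly h)"
  using integrable_poly_moment[of "\<lambda>x. x" "card S" h] moment by simp

lemma integrable_node_poly_mult:
  assumes "degree h \<le> card S"
  shows "integrable M (\<lambda>x. poly node_poly x * poly h x)"
proof -
  have "degree (node_poly * h) \<le> card S + card S"
    using degree_node_poly(1)[OF finite_nodes] assms
    by (intro order_trans[OF degree_mult_le]) auto
  moreover have "poly (node_poly * h) = (\<lambda>x. poly node_poly x * poly h x)" by (simp add: fun_eq_iff)
  ultimately show ?thesis using integrable_poly[of "node_poly * h"] by (simp only: mult_2)
qed

lemma orthogonal_poly: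
  assumes "degree h < card S"
  shows "(\<integral>x. poly node_poly x * poly h x \<partial>M) = 0"
proof (rule integral_mult_poly_eq_0[OF _ orthogonal assms])
  fix j assume "j < card S"
  then show "integrable M (\<lambda>x. poly node_poly x * x ^ j)"
    using integrable_node_poly_mult[of "monom 1 j"] by (simp add: poly_monom degree_monom_eq)
qed

lemma kernel_nonneg: "0 \<le> poly node_poly w * peano_kernel S w y"
  by (rule peano_kernel_nonneg[OF finite_nodes nodes_nonempty])

lemma integrable_kernel: "integrable M (\<lambda>w. poly node_poly w * peano_kernel S w y)"
proof -
  define h where "h = smult (1 / fact (card S - 1)) ([:- y, 1:] ^ (card S - 1))"
  have card: "card S \<ge> 1" using finite_nodes nodes_nonempty by (simp add: Suc_le_eq card_gt_0_iff)
  have dh: "degree h \<le> card S" unfolding h_def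
    by (auto intro!: order_trans[OF degree_smult_le] simp: degree_linear_power)
  have "integrable M (\<lambda>w. (poly node_poly w * poly h w) * indicator {y<..} w)"
    by (rule integrable_real_mult_indicator[OF _ integrable_node_poly_mult[OF dh]]) simp
  also have "(\<lambda>w. (poly node_poly w * poly h w) * indicator {y<..} w)
      = (\<lambda>w. poly node_poly w * truncated_power (card S) y w)"
    by (auto simp: fun_eq_iff truncated_power_def h_def poly_power indicator_def)
  finally have 1: "integrable M (\<lambda>w. poly node_poly w * truncated_power (card S) y w)" .
  have 2: "integrable M (\<lambda>w. poly node_poly w * poly (lagrange_basis S r) w)" if "r \<in> S" for r
    using degree_lagrange_basis[OF finite_nodes that] by (intro integrable_node_poly_mult) simp
  have "integrable M (\<lambda>w. poly node_poly w * truncated_power (card S) y w -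
      (\<Sum>r\<in>S. truncated_power (card S) y r * (poly node_poly w * poly (lagrange_basis S r) w)))"
    using 1 2 by auto
  then show ?thesis
    by (simp add: peano_kernel_def algebra_simps sum_distrib_left)
qed

lemma biased_density_nonneg: "0 \<le> biased_density y"
  unfolding biased_density_def by (rule Bochner_Integration.integral_nonneg) (rule kernel_nonneg)

lemma borel_measurable_biased_density [measurable]: "biased_density \<in> borel_measurable borel"
  unfolding biased_density_def by measurable

lemma interpolation_error_integral:
  fixes F :: "real \<Rightarrow> real"
  assumes int: "integrable M (\<lambda>w. poly node_poly w *
      (F w - (\<Sum>r\<in>S. F r * poly (lagrange_basis S r) w)))"
  shows "(\<integral>w. poly node_poly w * F w \<partial>M) = (\<integral>w. poly node_poly w *
      (F w - (\<Sum>r\<in>S. F r * poly (lagrange_basis S r) w)) \<partial>M)"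
proof -
  define H where "H = (\<Sum>r\<in>S. smult (F r) (lagrange_basis S r))"
  have card: "card S \<ge> 1" using finite_nodes nodes_nonempty by (simp add: Suc_le_eq card_gt_0_iff)
  have dH: "degree H < card S" unfolding H_def
    using degree_lagrange_basis[OF finite_nodes] card
    by (intro degree_sum_less) (auto intro: le_less_trans[OF degree_smult_le])
  have H: "(\<Sum>r\<in>S. F r * poly (lagrange_basis S r) w) = poly H w" for w
    by (simp add: H_def poly_sum)
  have intH: "integrable M (\<lambda>w. poly node_poly w * poly H w)"
    using dH by (intro integrable_node_poly_mult) simp
  have int': "integrable M (\<lambda>w. poly node_poly w * (F w - poly H w))"
    using int by (simp add: H)
  have split: "(\<lambda>w. poly node_poly w * F w)
      = (\<lambda>w. poly node_poly w * (F w - poly H w) + poly node_poly w * poly H w)"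
    by (simp add: algebra_simps)
  show ?thesis unfolding split H
    using int' intH orthogonal_poly[OF dH] by (subst Bochner_Integration.integral_add) auto
qed

text \<open>
  The interpolating polynomial contributes nothing by orthogonality, and the interpolation error is
  an integral against the kernel. Because \<open>poly node_poly w * peano_kernel S w y\<close> has no negative values, the
  integral over \<open>w\<close> of the absolute value of the integrand is
  \<open>biased_density y * \<bar>D (card S) y\<bar>\<close>, so the integrability hypothesis is exactly the condition for
  Fubini's theorem.
\<close>

lemma biased_identity:
  fixes D :: "nat \<Rightarrow> real \<Rightarrow> real"
  assumes der: "\<And>j x. j < card S \<Longrightarrow> (D j has_real_derivative D (Suc j) x) (at x)"
    and meas [measurable]: "D (card S) \<in> borel_measurable borel"
    and int: "integrable lborel (\<lambda>y. biased_density y * D (card S) y)"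
  shows "(\<integral>w. poly node_poly w * D 0 w \<partial>M) = (\<integral>y. biased_density y * D (card S) y \<partial>lborel)"
proof -
  define f where "f w y = poly node_poly w * peano_kernel S w y * D (card S) y" for w y
  define R where "R w = poly node_poly w *
      (D 0 w - (\<Sum>r\<in>S. D 0 r * poly (lagrange_basis S r) w))" for w
  have card: "card S > 0" using finite_nodes nodes_nonempty by (simp add: card_gt_0_iff)
  have "continuous_on UNIV (D 0)"
    by (auto intro!: continuous_at_imp_continuous_on DERIV_isCont der[OF card])
  then have D0 [measurable]: "D 0 \<in> borel_measurable borel"
    by (rule borel_measurable_continuous_onI)
  interpret pair_sigma_finite M lborel ..
  interpret Q: pair_sigma_finite lborel M ..
  have fm [measurable]: "case_prod f \<in> borel_measurable (M \<Otimes>\<^sub>M lborel)"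
    unfolding f_def by measurable
  have fm' [measurable]: "(\<lambda>(y, w). f w y) \<in> borel_measurable (lborel \<Otimes>\<^sub>M M)"
    unfolding f_def by measurable
  have inner: "(\<integral>w. f w y \<partial>M) = biased_density y * D (card S) y" for y
    by (simp add: f_def biased_density_def)
  have inner_abs: "(\<integral>w. norm (f w y) \<partial>M) = norm (biased_density y * D (card S) y)" for y
  proof -
    have "norm (f w y) = poly node_poly w * peano_kernel S w y * \<bar>D (card S) y\<bar>" for w
      unfolding f_def real_norm_def abs_mult[of _ "D (card S) y"] using kernel_nonneg by simp
    then have "(\<integral>w. norm (f w y) \<partial>M) = biased_density y * \<bar>D (card S) y\<bar>"
      by (simp add: biased_density_def)
    then show ?thesis using biased_density_nonneg[of y] by (simp add: abs_mult)
  qed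
  have "integrable (lborel \<Otimes>\<^sub>M M) (\<lambda>(y, w). f w y)"
  proof (rule Q.Fubini_integrable)
    show "integrable lborel (\<lambda>y. \<integral>w. norm (case (y, w) of (y, w) \<Rightarrow> f w y) \<partial>M)"
      unfolding prod.case inner_abs using int by (rule integrable_norm)
    show "AE y in lborel. integrable M (\<lambda>w. case (y, w) of (y, w) \<Rightarrow> f w y)"
      using integrable_kernel by (simp add: f_def)
  qed simp
  then have fi: "integrable (M \<Otimes>\<^sub>M lborel) (case_prod f)"
    using integrable_product_swap_iff[of "case_prod f"] by simp
  \<comment> \<open>Fubini provides Lebesgue integrability for almost every \<open>w\<close>; there the gauge integral agrees.\<close>
  have ae: "AE w in M. (\<integral>y. f w y \<partial>lborel) = R w"
    using AE_integrable_fst[OF fi]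
  proof eventually_elim
    fix w assume i: "integrable lborel (f w)"
    have "((\<lambda>y. poly node_poly w * (peano_kernel S w y * D (card S) y)) has_integral R w) UNIV"
      unfolding R_def
      by (intro has_integral_mult_right peano_kernel_has_integral finite_nodes nodes_nonempty der)
    then have "(f w has_integral R w) UNIV" by (simp add: f_def[abs_def] mult.assoc)
    then show "(\<integral>y. f w y \<partial>lborel) = R w"
      using has_integral_integral_lborel[OF i] has_integral_unique by blast
  qed
  have Rm [measurable]: "R \<in> borel_measurable M" unfolding R_def by measurable
  have Ri: "integrable M R"
    using integrable_fst[OF fi] ae by (subst integrable_cong_AE[symmetric, OF _ _ ae]) auto
  have "(\<integral>w. poly node_poly w * D 0 w \<partial>M) = (\<integral>w. R w \<partial>M)"
    using interpolation_error_integral[of "D 0"] Ri by (simp add: R_def[abs_def])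
  also have "\<dots> = (\<integral>w. \<integral>y. f w y \<partial>lborel \<partial>M)"
    using ae by (intro integral_cong_AE) (auto elim: eventually_mono)
  also have "\<dots> = (\<integral>y. \<integral>w. f w y \<partial>M \<partial>lborel)"
    using Fubini_integral[OF fi] by simp
  finally show ?thesis by (simp add: inner)
qed

text \<open>
  The case \<open>F(x) = x\<^sup>m / m!\<close> with \<open>m = card S\<close>, whose \<open>m\<close>-th derivative is 1. Integrability of the density is not yet
  known, so Fubini's theorem is first applied in the other order, where the inner integrals are
  interpolation errors of a polynomial.
\<close>

lemma biased_density_integral:
  shows "integrable lborel biased_density"
    and "(\<integral>y. biased_density y \<partial>lborel) = (\<integral>w. poly node_poly w * w ^ card S \<partial>M) / fact (card S)"
proof -
  define D :: "nat \<Rightarrow> real \<Rightarrow> real" where "D j x = x ^ (card S - j) / fact (card S - j)" for j x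
  have der: "(D j has_real_derivative D (Suc j) x) (at x)" if "j < card S" for j x
  proof -
    define k where "k = card S - Suc j"
    then have k: "card S - j = Suc k" and k': "card S - Suc j = k"
      using that by (simp_all add: Suc_diff_Suc)
    have "((\<lambda>x::real. x ^ Suc k / fact (Suc k)) has_real_derivative
        real (Suc k) * x ^ k / fact (Suc k)) (at x)"
      by (auto intro!: derivative_eq_intros simp del: power_Suc fact_Suc)
    also have "real (Suc k) * x ^ k / fact (Suc k) = x ^ k / fact k"
      unfolding fact_Suc by (rule mult_divide_mult_cancel_left) simp
    finally show ?thesis unfolding D_def k k' .
  qed
  have D1: "D (card S) = (\<lambda>_. 1)" by (simp add: D_def fun_eq_iff)
  define f where "f w y = poly node_poly w * peano_kernel S w y" for w y
  define R where "R w = poly node_poly w *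
      (D 0 w - (\<Sum>r\<in>S. D 0 r * poly (lagrange_basis S r) w))" for w
  interpret pair_sigma_finite M lborel ..
  have fm [measurable]: "case_prod f \<in> borel_measurable (M \<Otimes>\<^sub>M lborel)"
    unfolding f_def by measurable
  have f0: "0 \<le> f w y" for w y unfolding f_def by (rule kernel_nonneg)
  have hi: "(f w has_integral R w) UNIV" for w
  proof -
    have "((\<lambda>y. poly node_poly w * (peano_kernel S w y * D (card S) y)) has_integral R w) UNIV"
      unfolding R_def
      by (intro has_integral_mult_right peano_kernel_has_integral finite_nodes nodes_nonempty der)
    then show ?thesis by (simp add: f_def[abs_def] D1)
  qed
  have fw [measurable]: "f w \<in> borel_measurable borel" for w unfolding f_def by measurable
  have nn: "(\<integral>\<^sup>+y. f w y \<partial>lborel) = R w" for w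
    using nn_integral_has_integral_lborel[OF fw f0 hi] .
  have R0: "0 \<le> R w" for w using has_integral_nonneg[OF hi] f0 by auto
  have fi: "integrable lborel (f w)" for w
    using nn R0 f0 by (intro integrableI_nonneg) auto
  have fR: "(\<integral>y. f w y \<partial>lborel) = R w" for w
    using has_integral_integral_lborel[OF fi] hi has_integral_unique by blast
  have "integrable M R"
  proof -
    have "integrable M (\<lambda>w. poly node_poly w * poly
        (monom (1 / fact (card S)) (card S) - (\<Sum>r\<in>S. smult (D 0 r) (lagrange_basis S r))) w)"
    proof (rule integrable_node_poly_mult, rule degree_diff_le)
      show "degree (\<Sum>r\<in>S. smult (D 0 r) (lagrange_basis S r)) \<le> card S"
        using degree_lagrange_basis[OF finite_nodes]
        by (intro degree_sum_le finite_nodes) (auto intro!: order_trans[OF degree_smult_le] less_imp_le)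
    qed (simp add: degree_monom_le)
    then show ?thesis by (simp add: R_def[abs_def] D_def poly_monom poly_sum)
  qed
  then have "integrable (M \<Otimes>\<^sub>M lborel) (case_prod f)"
    by (intro Fubini_integrable fm) (use f0 fR fi in auto)
  from integrable_snd[OF this] show *: "integrable lborel biased_density"
    by (simp add: f_def biased_density_def[abs_def])
  have "(\<integral>w. poly node_poly w * D 0 w \<partial>M) = (\<integral>y. biased_density y * D (card S) y \<partial>lborel)"
    using biased_identity[of D] der by (simp add: D1 *)
  then show "(\<integral>y. biased_density y \<partial>lborel)
      = (\<integral>w. poly node_poly w * w ^ card S \<partial>M) / fact (card S)"
    by (simp add: D_def)
qed

end

section \<open>Orthogonal polynomials have simple real roots\<close>

text \<open>
  Squares of linear factors can be divided out until no real root is left; then the intermediate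
  value theorem fixes the sign.
\<close>

lemma poly_nonneg_of_even_orders:
  fixes q :: "real poly"
  assumes "lead_coeff q > 0" "\<And>r. even (order r q)"
  shows "0 \<le> poly q x"
  using assms
proof (induction "degree q" arbitrary: q rule: less_induct)
  case less
  have q0: "q \<noteq> 0" using less.prems(1) by auto
  show ?case
  proof (cases "\<exists>a. poly q a = 0")
    case True
    then obtain a where "poly q a = 0" by blast
    then have "order a q \<noteq> 0" using q0 by (simp add: order_root)
    then have "2 \<le> order a q" using less.prems(2)[of a] by (cases "order a q = 1") auto
    then have "[:- a, 1:] ^ 2 dvd q" using order_divides by blast
    then obtain g where g: "q = [:- a, 1:] ^ 2 * g" by (auto simp: dvd_def)
    have g0: "g \<noteq> 0" using q0 g by auto
    have "0 \<le> poly g x"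
    proof (rule less.hyps)
      show "degree g < degree q" unfolding g using g0
        by (subst degree_mult_eq) (auto simp: degree_linear_power)
      show "lead_coeff g > 0"
        using less.prems(1) unfolding g lead_coeff_mult by (simp add: lead_coeff_power)
      fix r
      have "order r q = order r ([:- a, 1:] ^ 2) + order r g"
        using q0 unfolding g by (intro order_mult) simp
      moreover have "order r ([:- a, 1:] ^ 2) = (if r = a then 2 else 0)"
        by (auto simp: order_power_n_n intro: order_0I)
      ultimately show "even (order r g)" using less.prems(2)[of r] by (auto split: if_splits)
    qed
    then show ?thesis by (simp add: g poly_power)
  next
    case False
    show ?thesis
    proof (rule ccontr)
      assume neg: "\<not> ?thesis"
      obtain n where n: "\<forall>x\<ge>n. lead_coeff q \<le> poly q x"
        using poly_pinfty_gt_lc[OF less.prems(1)] by blast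
      have "poly q (max n (x + 1)) > 0" using n less.prems(1) by (meson less_le_trans max.cobounded1)
      moreover have "x < max n (x + 1)" by (simp add: less_max_iff_disj)
      ultimately show False using poly_IVT_pos[of x "max n (x + 1)" q] neg False by auto
    qed
  qed
qed

lemma order_node_poly:
  fixes S :: "real set"
  assumes "finite S"
  shows "order r (\<Prod>s\<in>S. [:- s, 1:]) = (if r \<in> S then 1 else 0)"
  using assms
proof (induction S rule: finite_induct)
  case empty
  then show ?case by (simp add: order_0I)
next
  case (insert s S)
  have "order r ([:- s, 1:] * (\<Prod>s\<in>S. [:- s, 1:])) = order r [:- s, 1:] + order r (\<Prod>s\<in>S. [:- s, 1:])"
  proof (rule order_mult)
    have "(\<Prod>s\<in>S. [:- s, 1:]) \<noteq> 0" using insert.hyps by (subst prod_zero_iff) auto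
    then show "[:- s, 1:] * (\<Prod>s\<in>S. [:- s, 1:]) \<noteq> 0" by (simp only: mult_eq_0_iff) simp
  qed
  moreover have "order r [:- s, 1:] = (if r = s then 1 else 0)"
    using order_power_n_n[of r 1] by (auto intro: order_0I)
  ultimately show ?case using insert by auto
qed

text \<open>
  Let \<open>t\<close> be the product of the linear factors belonging to the roots of odd order. Then \<open>p t\<close> has
  only roots of even order and is nonnegative. If \<open>t\<close> had smaller degree than \<open>p\<close>, orthogonality would
  make the integral of \<open>p t\<close> zero, so \<open>p = 0\<close> almost everywhere, against the positivity of the
  integral of \<open>p\<^sup>2\<close>.
\<close>

lemma (in real_distribution) orthogonal_poly_simple_roots:
  fixes p :: "real poly"
  assumes monic: "degree p = m" "lead_coeff p = 1"
    and moment: "integrable M (\<lambda>x. x ^ (2 * m))"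
    and orth: "\<And>j. j < m \<Longrightarrow> (\<integral>x. poly p x * x ^ j \<partial>M) = 0"
    and pos: "(\<integral>x. (poly p x)\<^sup>2 \<partial>M) > 0"
  shows "\<exists>S. finite S \<and> card S = m \<and> p = (\<Prod>r\<in>S. [:- r, 1:])"
proof -
  define S where "S = {r. odd (order r p)}"
  define t where "t = (\<Prod>r\<in>S. [:- r, 1:])"
  have p0: "p \<noteq> 0" using monic by auto
  have root: "poly p r = 0" if "r \<in> S" for r
    using that p0 by (auto simp: S_def order_root intro: odd_pos)
  have fS: "finite S" by (rule finite_subset[OF _ poly_roots_finite[OF p0]]) (use root in auto)
  have "card S \<le> card {r. poly p r = 0}"
    by (rule card_mono[OF poly_roots_finite[OF p0]]) (use root in auto)
  also have "\<dots> \<le> m" using card_poly_roots_bound[OF p0] monic by simp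
  finally have "card S \<le> m" .
  have t: "degree t = card S" "lead_coeff t = 1" using degree_node_poly[OF fS] by (auto simp: t_def)
  have t0: "t \<noteq> 0" using t(2) by auto
  have int: "integrable M (\<lambda>x. poly p x * poly h x)" if "degree h \<le> m" for h
  proof -
    have "degree (p * h) \<le> 2 * m" using that monic by (intro order_trans[OF degree_mult_le]) auto
    then show ?thesis
      using integrable_poly_moment[of "\<lambda>x. x" m "p * h"] moment by simp
  qed
  have nn: "0 \<le> poly p x * poly t x" for x
  proof -
    have "0 \<le> poly (p * t) x"
    proof (rule poly_nonneg_of_even_orders)
      show "0 < lead_coeff (p * t)" using monic t by (simp add: lead_coeff_mult)
      fix r
      have "order r (p * t) = order r p + order r t" using p0 t0 by (intro order_mult) simp
      then show "even (order r (p * t))"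
        unfolding t_def order_node_poly[OF fS] by (auto simp: S_def)
    qed
    then show ?thesis by simp
  qed
  have "card S = m"
  proof (rule ccontr)
    assume "card S \<noteq> m"
    then have lt: "degree t < m" using \<open>card S \<le> m\<close> t by simp
    have "(\<integral>x. poly p x * poly t x \<partial>M) = 0"
    proof (rule integral_mult_poly_eq_0[OF _ orth lt])
      fix j assume "j < m"
      then show "integrable M (\<lambda>x. poly p x * x ^ j)"
        using int[of "monom 1 j"] by (simp add: poly_monom degree_monom_eq)
    qed
    then have "AE x in M. poly p x * poly t x = 0"
      using integral_nonneg_eq_0_iff_AE[OF int] nn lt by auto
    then have "AE x in M. (poly p x)\<^sup>2 = 0"
    proof eventually_elim
      fix x assume "poly p x * poly t x = 0"
      then show "(poly p x)\<^sup>2 = 0"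
        using root fS by (auto simp: t_def poly_prod prod_zero_iff)
    qed
    then have "(\<integral>x. (poly p x)\<^sup>2 \<partial>M) = 0" by (rule integral_eq_zero_AE)
    then show False using pos by simp
  qed
  moreover have "p = t"
    by (rule poly_eqI_degree_lead_coeff[where A = S and n = m])
      (use \<open>card S = m\<close> monic t root fS in \<open>auto simp: t_def poly_prod prod_zero_iff\<close>)
  ultimately show ?thesis using fS t_def by blast
qed

section \<open>The bias identity on the Fourier side\<close>

lemma higher_deriv_eq:
  fixes D :: "nat \<Rightarrow> real \<Rightarrow> real"
  assumes "\<And>j x. (D j has_real_derivative D (Suc j) x) (at x)"
  shows "(deriv ^^ j) (D 0) = D j"
proof (induction j)
  case (Suc j)
  have "deriv (D j) = D (Suc j)" using assms by (intro ext DERIV_imp_deriv)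
  then show ?case by (simp add: Suc.IH)
qed simp

text \<open>
  The \<open>j\<close>-th derivative of \<open>cos (t x + \<theta>)\<close>: each differentiation advances the phase by \<open>\<pi>/2\<close>. The
  free phase \<open>\<theta>\<close> covers sine and cosine by one family.
\<close>

definition cos_deriv :: "real \<Rightarrow> real \<Rightarrow> nat \<Rightarrow> real \<Rightarrow> real" where
  "cos_deriv t \<theta> j x = t ^ j * cos (t * x + \<theta> + j * (pi / 2))"

lemma has_real_derivative_cos_deriv:
  "(cos_deriv t \<theta> j has_real_derivative cos_deriv t \<theta> (Suc j) x) (at x)"
proof -
  have "(cos_deriv t \<theta> j has_real_derivative t ^ j * (- sin (t * x + \<theta> + j * (pi / 2)) * t)) (at x)"
    unfolding cos_deriv_def[abs_def] by (auto intro!: derivative_eq_intros)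
  also have "- sin (t * x + \<theta> + j * (pi / 2)) = cos (t * x + \<theta> + Suc j * (pi / 2))"
    using cos_add[of "t * x + \<theta> + j * (pi / 2)" "pi / 2"] by (simp add: algebra_simps add_divide_distrib)
  finally show ?thesis by (simp add: cos_deriv_def[abs_def] mult_ac)
qed

text \<open>
  The phases \<open>0\<close> and \<open>- \<pi>/2\<close> give the real and the imaginary part, because multiplication by
  \<open>\<i>\<^sup>k\<close> advances the argument by \<open>k \<pi>/2\<close>, just as \<open>k\<close> differentiations do.
\<close>

lemma iexp_identity_of_cos_identities:
  fixes f X :: "'a \<Rightarrow> real" and Y :: "'b \<Rightarrow> real"
  assumes [measurable]: "X \<in> borel_measurable M" and f: "integrable M f"
    and N: "finite_measure N" and [measurable]: "Y \<in> borel_measurable N"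
    and id: "\<And>\<theta>. (\<integral>\<omega>. f \<omega> * cos_deriv t \<theta> 0 (X \<omega>) \<partial>M) = \<alpha> * (\<integral>\<omega>. cos_deriv t \<theta> k (Y \<omega>) \<partial>N)"
  shows "(\<integral>\<omega>. f \<omega> * iexp (t * X \<omega>) \<partial>M) = \<alpha> * (\<i> * t) ^ k * (\<integral>\<omega>. iexp (t * Y \<omega>) \<partial>N)"
proof -
  interpret N: finite_measure N by fact
  have fi: "integrable M (\<lambda>\<omega>. f \<omega> * iexp (t * X \<omega>))"
    by (rule Bochner_Integration.integrable_bound[OF f])
      (use f in \<open>auto simp: norm_mult intro!: borel_measurable_times borel_measurable_of_real\<close>)
  have cis: "iexp y = cis y" for y by (simp only: cis_conv_exp)
  have ik: "\<i> ^ k * iexp y = cis (y + k * (pi / 2))" for y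
  proof -
    have "\<i> ^ k = cis (k * (pi / 2))" unfolding cis_pi_half[symmetric] by (rule Complex.DeMoivre)
    then show ?thesis unfolding cis by (simp add: cis_mult add.commute)
  qed
  have gi: "integrable N (\<lambda>\<omega>. t ^ k * cis (t * Y \<omega> + k * (pi / 2)))"
  proof (rule N.integrable_const_bound)
    show "(\<lambda>\<omega>. t ^ k * cis (t * Y \<omega> + k * (pi / 2))) \<in> borel_measurable N"
      unfolding cis_conv_exp by measurable
  qed (auto simp: norm_mult)
  have rhs: "\<alpha> * (\<i> * t) ^ k * (\<integral>\<omega>. iexp (t * Y \<omega>) \<partial>N)
      = \<alpha> * (\<integral>\<omega>. t ^ k * cis (t * Y \<omega> + k * (pi / 2)) \<partial>N)"
    unfolding ik[symmetric] by (simp add: power_mult_distrib)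
  show ?thesis unfolding rhs
  proof (rule complex_eqI)
    have "Re (\<integral>\<omega>. f \<omega> * iexp (t * X \<omega>) \<partial>M) = (\<integral>\<omega>. f \<omega> * cos_deriv t 0 0 (X \<omega>) \<partial>M)"
      unfolding integral_Re[OF fi, symmetric]
      unfolding cis by (simp add: cos_deriv_def)
    also have "\<dots> = \<alpha> * Re (\<integral>\<omega>. t ^ k * cis (t * Y \<omega> + k * (pi / 2)) \<partial>N)"
      unfolding id integral_Re[OF gi, symmetric]
      by (simp add: cos_deriv_def flip: of_real_power)
    finally show "Re (\<integral>\<omega>. f \<omega> * iexp (t * X \<omega>) \<partial>M)
        = Re (\<alpha> * (\<integral>\<omega>. t ^ k * cis (t * Y \<omega> + k * (pi / 2)) \<partial>N))" by simp
  next
    have sc: "sin x = cos (x - pi / 2)" for x :: real by (simp add: cos_diff)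
    have "Im (\<integral>\<omega>. f \<omega> * iexp (t * X \<omega>) \<partial>M) = (\<integral>\<omega>. f \<omega> * cos_deriv t (- (pi / 2)) 0 (X \<omega>) \<partial>M)"
      unfolding integral_Im[OF fi, symmetric]
      unfolding cis by (simp add: cos_deriv_def sc)
    also have "\<dots> = \<alpha> * Im (\<integral>\<omega>. t ^ k * cis (t * Y \<omega> + k * (pi / 2)) \<partial>N)"
      unfolding id integral_Im[OF gi, symmetric]
      by (simp add: cos_deriv_def sc algebra_simps flip: of_real_power)
    finally show "Im (\<integral>\<omega>. f \<omega> * iexp (t * X \<omega>) \<partial>M)
        = Im (\<alpha> * (\<integral>\<omega>. t ^ k * cis (t * Y \<omega> + k * (pi / 2)) \<partial>N))" by simp
  qed
qed

lemma (in prob_space) integrable_cos_deriv: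
  assumes [measurable]: "Y \<in> borel_measurable M"
  shows "integrable M (\<lambda>\<omega>. cos_deriv t \<theta> k (Y \<omega>))"
  by (rule integrable_const_bound[where B = "\<bar>t\<bar> ^ k"])
    (auto simp: cos_deriv_def abs_mult power_abs mult_left_le)

lemma has_biased_distribution_iexp:
  assumes b: "has_biased_distribution L P l k M X N Y"
    and N: "prob_space N"
    and int: "integrable M (\<lambda>\<omega>. poly (P l k) (X \<omega>))"
  shows "(\<integral>\<omega>. poly (P l k) (X \<omega>) * iexp (t * X \<omega>) \<partial>M)
    = alpha L P l k * (\<i> * t) ^ k * (\<integral>\<omega>. iexp (t * Y \<omega>) \<partial>N)"
proof (rule iexp_identity_of_cos_identities[OF _ int])
  show [measurable]: "X \<in> borel_measurable M" and Y [measurable]: "Y \<in> borel_measurable N"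
    using b by (auto simp: has_biased_distribution_def moment_class_def)
  interpret N: prob_space N by fact
  show "finite_measure N" by unfold_locales
  fix \<theta>
  have D: "(deriv ^^ j) (cos_deriv t \<theta> 0) = cos_deriv t \<theta> j" for j
    using has_real_derivative_cos_deriv by (rule higher_deriv_eq)
  have m [measurable]: "cos_deriv t \<theta> j \<in> borel_measurable borel" for j
    unfolding cos_deriv_def[abs_def] by measurable
  have "integrable M (\<lambda>\<omega>. poly (P l k) (X \<omega>) * cos_deriv t \<theta> 0 (X \<omega>))"
    by (rule Bochner_Integration.integrable_bound[OF int])
      (auto simp: cos_deriv_def abs_mult mult_left_le)
  moreover have "cos_deriv t \<theta> j field_differentiable at x" for j x
    using has_real_derivative_cos_deriv field_differentiable_def by blast
  ultimately have "cos_deriv t \<theta> 0 \<in> test_functions k (P l k) M X"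
    by (auto simp: test_functions_def D)
  then show "(\<integral>\<omega>. poly (P l k) (X \<omega>) * cos_deriv t \<theta> 0 (X \<omega>) \<partial>M)
      = alpha L P l k * (\<integral>\<omega>. cos_deriv t \<theta> k (Y \<omega>) \<partial>N)"
    using b N.integrable_cos_deriv[OF Y, of t \<theta> k] by (auto simp: has_biased_distribution_def D)
qed

text \<open>
  For \<open>m = 0\<close> both laws coincide. For \<open>m \<ge> 1\<close> the law with density \<open>biased_density / \<alpha>\<close> satisfies the
  bias identity, hence also the Fourier relation, which determines a characteristic function at
  every \<open>t \<noteq> 0\<close>; at \<open>t = 0\<close> it is always 1. So \<open>N\<close> is that law.
\<close>

theorem biased_identity_of_iexp_identity:
  fixes M N :: "real measure" and p :: "real poly"
  assumes M: "real_distribution M" and N: "real_distribution N"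
    and monic: "degree p = m" "lead_coeff p = 1"
    and moment: "integrable M (\<lambda>x. x ^ (2 * m))"
    and orth: "\<And>j. j < m \<Longrightarrow> (\<integral>x. poly p x * x ^ j \<partial>M) = 0"
    and pos: "(\<integral>x. (poly p x)\<^sup>2 \<partial>M) > 0"
    and \<alpha>: "\<alpha> = (\<integral>x. poly p x * x ^ m \<partial>M) / fact m" "\<alpha> > 0"
    and char: "\<And>t. (\<integral>x. poly p x * iexp (t * x) \<partial>M) = \<alpha> * (\<i> * t) ^ m * char N t"
    and F: "\<And>j x. j < m \<Longrightarrow> (D j has_real_derivative D (Suc j) x) (at x)"
      "D m \<in> borel_measurable borel" "integrable N (D m)"
  shows "(\<integral>x. poly p x * D 0 x \<partial>M) = \<alpha> * (\<integral>y. D m y \<partial>N)"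
proof -
  interpret M: real_distribution M by fact
  interpret N: real_distribution N by fact
  show ?thesis
  proof (cases "m = 0")
    case True
    then have p: "p = 1" using monic degree0_coeffs[of p] by (auto simp: one_pCons)
    have a: "\<alpha> = 1" using \<alpha>(1) M.prob_space by (simp add: True p)
    have "char M t = char N t" for t using char[of t] by (simp add: p a True char_def)
    then have "M = N" by (intro Levy_uniqueness M N) auto
    then show ?thesis by (simp add: p a True)
  next
    case False
    obtain S where S: "finite S" "card S = m" "p = (\<Prod>r\<in>S. [:- r, 1:])"
      using M.orthogonal_poly_simple_roots[OF monic moment orth pos] by blast
    interpret S: orthogonal_node_law M S
      using S False moment orth by unfold_locales auto
    define q where "q y = S.biased_density y / \<alpha>" for y
    define Q where "Q = density lborel (\<lambda>y. ennreal (q y))"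
    have q0: "0 \<le> q y" for y using S.biased_density_nonneg \<alpha>(2) by (simp add: q_def)
    have qm [measurable]: "q \<in> borel_measurable borel" unfolding q_def by measurable
    have qi: "integrable lborel q" and q1: "(\<integral>y. q y \<partial>lborel) = 1"
      using S.biased_density_integral \<alpha> S(2) by (auto simp: q_def[abs_def] S(3))
    have "(\<integral>\<^sup>+y. q y \<partial>lborel) = 1"
      using nn_integral_eq_integral[OF qi] q0 q1 by simp
    then have Q: "real_distribution Q"
      by (intro real_distribution.intro prob_spaceI real_distribution_axioms.intro)
        (auto simp: Q_def emeasure_density)
    interpret Q: real_distribution Q by fact
    have Qint: "(\<integral>y. G y \<partial>Q) = (\<integral>y. S.biased_density y * G y \<partial>lborel) / \<alpha>"
      and Qi: "integrable Q G \<longleftrightarrow> integrable lborel (\<lambda>y. S.biased_density y * G y)"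
      if [measurable]: "G \<in> borel_measurable borel" for G :: "real \<Rightarrow> real"
    proof -
      show "(\<integral>y. G y \<partial>Q) = (\<integral>y. S.biased_density y * G y \<partial>lborel) / \<alpha>"
        unfolding Q_def using q0 by (subst integral_density) (auto simp: q_def)
      have "integrable Q G \<longleftrightarrow> integrable lborel (\<lambda>y. q y *\<^sub>R G y)"
        unfolding Q_def using q0 by (subst integrable_density) auto
      also have "(\<lambda>y. q y *\<^sub>R G y) = (\<lambda>y. inverse \<alpha> * (S.biased_density y * G y))"
        by (simp add: q_def fun_eq_iff field_simps)
      finally show "integrable Q G \<longleftrightarrow> integrable lborel (\<lambda>y. S.biased_density y * G y)"
        using \<alpha>(2) by (simp add: integrable_mult_left_iff)
    qed
    have main: "(\<integral>x. poly p x * D 0 x \<partial>M) = \<alpha> * (\<integral>y. D m y \<partial>Q)"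
      if "\<And>j x. j < m \<Longrightarrow> (D j has_real_derivative D (Suc j) x) (at x)"
        "D m \<in> borel_measurable borel" "integrable Q (D m)" for D
      using S.biased_identity[of D] that \<alpha>(2) S(2,3) Qi[of "D m"] Qint[of "D m"] by simp
    have pint: "integrable M (poly p)" using S.integrable_poly[of p] S(2) monic by simp
    have charQ: "(\<integral>x. poly p x * iexp (t * x) \<partial>M) = \<alpha> * (\<i> * t) ^ m * char Q t" for t
      unfolding char_def
    proof (rule iexp_identity_of_cos_identities[OF _ pint])
      fix \<theta>
      have "cos_deriv t \<theta> m \<in> borel_measurable borel"
        unfolding cos_deriv_def[abs_def] by measurable
      then show "(\<integral>x. poly p x * cos_deriv t \<theta> 0 x \<partial>M) = \<alpha> * (\<integral>y. cos_deriv t \<theta> m y \<partial>Q)"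
        using main[of "cos_deriv t \<theta>"] has_real_derivative_cos_deriv
          Q.integrable_cos_deriv[of "\<lambda>y. y" t \<theta> m] by simp
    qed (auto simp: Q.finite_measure_axioms)
    have "char N t = char Q t" for t
    proof (cases "t = 0")
      case True
      then show ?thesis by (simp add: N.char_zero Q.char_zero)
    next
      case False
      then show ?thesis using char[of t] charQ[of t] \<alpha>(2) by simp
    qed
    then have "N = Q" by (intro Levy_uniqueness N Q) auto
    then show ?thesis using main[of D] F by simp
  qed
qed

section \<open>Multi-indices and moments\<close>

lemma multi_index_le:
  assumes "\<mu> \<in> multi_indices n m" "i \<in> {1..n}"
  shows "\<mu> i \<le> m"
proof -
  have "\<mu> i \<le> (\<Sum>i\<in>{1..n}. \<mu> i)" by (rule member_le_sum) (use assms in auto)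
  then show ?thesis using assms by (simp add: multi_indices_def)
qed

lemma finite_multi_indices: "finite (multi_indices n m)"
proof (rule finite_subset)
  show "multi_indices n m \<subseteq> {1..n} \<rightarrow>\<^sub>E {..m}"
  proof
    fix \<mu> assume \<mu>: "\<mu> \<in> multi_indices n m"
    then have "\<mu> \<in> {1..n} \<rightarrow>\<^sub>E UNIV" by (simp add: multi_indices_def)
    then show "\<mu> \<in> {1..n} \<rightarrow>\<^sub>E {..m}" using multi_index_le[OF \<mu>] by (simp add: PiE_iff)
  qed
  show "finite ({1..n} \<rightarrow>\<^sub>E {..m})" by (rule finite_PiE) simp_all
qed

text \<open>
  A multi-index of length \<open>n + 1\<close> is its last entry together with its restriction to the first \<open>n\<close>
  places.
\<close>

lemma sum_multi_indices_Suc: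
  fixes g :: "nat \<Rightarrow> nat \<Rightarrow> real"
  shows "(\<Sum>\<mu>\<in>multi_indices (Suc n) m. \<Prod>i\<in>{1..Suc n}. g i (\<mu> i))
    = (\<Sum>j\<le>m. g (Suc n) j * (\<Sum>\<mu>\<in>multi_indices n (m - j). \<Prod>i\<in>{1..n}. g i (\<mu> i)))"
proof -
  have split: "{1..Suc n} = insert (Suc n) {1..n}" by auto
  have "(\<Sum>j\<le>m. g (Suc n) j * (\<Sum>\<mu>\<in>multi_indices n (m - j). \<Prod>i\<in>{1..n}. g i (\<mu> i)))
      = (\<Sum>(j, \<mu>)\<in>(SIGMA j:{..m}. multi_indices n (m - j)). g (Suc n) j * (\<Prod>i\<in>{1..n}. g i (\<mu> i)))"
    by (simp add: sum_distrib_left sum.Sigma finite_multi_indices)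
  also have "\<dots> = (\<Sum>\<mu>\<in>multi_indices (Suc n) m. \<Prod>i\<in>{1..Suc n}. g i (\<mu> i))"
  proof (rule sum.reindex_bij_witness[where
        i = "\<lambda>\<mu>. (\<mu> (Suc n), restrict \<mu> {1..n})" and j = "\<lambda>(j, \<mu>). \<mu>(Suc n := j)"])
    fix a assume a: "a \<in> (SIGMA j:{..m}. multi_indices n (m - j))"
    obtain j \<mu> where p: "a = (j, \<mu>)" by force
    have j: "j \<le> m" and \<mu>: "\<mu> \<in> {1..n} \<rightarrow>\<^sub>E UNIV" "(\<Sum>i\<in>{1..n}. \<mu> i) = m - j"
      using a p by (auto simp: multi_indices_def)
    have eq: "(\<Sum>i\<in>{1..n}. (\<mu>(Suc n := j)) i) = (\<Sum>i\<in>{1..n}. \<mu> i)"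
      by (intro sum.cong) auto
    have eq': "(\<Prod>i\<in>{1..n}. g i ((\<mu>(Suc n := j)) i)) = (\<Prod>i\<in>{1..n}. g i (\<mu> i))"
      by (intro prod.cong) auto
    show "(case a of (j, \<mu>) \<Rightarrow> \<mu>(Suc n := j)) \<in> multi_indices (Suc n) m"
      using j \<mu> eq by (auto simp: p multi_indices_def split PiE_def extensional_def)
    show "(\<Prod>i\<in>{1..Suc n}. g i ((case a of (j, \<mu>) \<Rightarrow> \<mu>(Suc n := j)) i))
        = (case a of (j, \<mu>) \<Rightarrow> g (Suc n) j * (\<Prod>i\<in>{1..n}. g i (\<mu> i)))"
      unfolding p split using eq' by simp
    show "((case a of (j, \<mu>) \<Rightarrow> \<mu>(Suc n := j)) (Suc n),
        restrict (case a of (j, \<mu>) \<Rightarrow> \<mu>(Suc n := j)) {1..n}) = a"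
      using \<mu>(1) by (auto simp: p fun_eq_iff PiE_def extensional_def restrict_def)
  next
    fix \<mu> assume \<mu>: "\<mu> \<in> multi_indices (Suc n) m"
    then show "(\<mu> (Suc n), restrict \<mu> {1..n}) \<in> (SIGMA j:{..m}. multi_indices n (m - j))"
      by (auto simp: multi_indices_def split)
    show "(case (\<mu> (Suc n), restrict \<mu> {1..n}) of (j, \<mu>) \<Rightarrow> \<mu>(Suc n := j)) = \<mu>"
      using \<mu> by (auto simp: multi_indices_def fun_eq_iff PiE_def extensional_def restrict_def)
  qed
  finally show ?thesis by simp
qed

text \<open>
  Divided by factorials, the multinomial theorem has coefficients 1 and follows from the binomial
  theorem in the same normalization by induction on \<open>n\<close>.
\<close>

lemma multinomial_theorem:
  fixes x :: "nat \<Rightarrow> real"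
  shows "(\<Sum>i\<in>{1..n}. x i) ^ m / fact m
    = (\<Sum>\<mu>\<in>multi_indices n m. \<Prod>i\<in>{1..n}. x i ^ \<mu> i / fact (\<mu> i))"
proof (induction n arbitrary: m)
  case 0
  have "multi_indices 0 m = (if m = 0 then {\<lambda>_. undefined} else {})"
    by (auto simp: multi_indices_def)
  then show ?case by (auto simp: power_0_left)
next
  case (Suc n)
  have "(\<Sum>i\<in>{1..Suc n}. x i) ^ m / fact m = (x (Suc n) + (\<Sum>i\<in>{1..n}. x i)) ^ m / fact m"
    by (simp add: add.commute)
  also have "\<dots> = (\<Sum>j\<le>m. x (Suc n) ^ j / fact j * ((\<Sum>i\<in>{1..n}. x i) ^ (m - j) / fact (m - j)))"
    using exp_series_add_commuting[of "x (Suc n)" "\<Sum>i\<in>{1..n}. x i" m]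
    by (simp add: divide_inverse mult_ac)
  also have "\<dots> = (\<Sum>\<mu>\<in>multi_indices (Suc n) m. \<Prod>i\<in>{1..Suc n}. x i ^ \<mu> i / fact (\<mu> i))"
    unfolding Suc.IH using sum_multi_indices_Suc[of "\<lambda>i k. x i ^ k / fact k" n m] by simp
  finally show ?case .
qed

lemma moment_class_poly:
  fixes Z :: "real measure"
  assumes X: "X \<in> moment_class Z m M" and Z: "real_distribution Z" "integrable Z (\<lambda>z. z ^ (2 * m))"
    and M: "prob_space M" and deg: "degree h \<le> 2 * m"
  shows "integrable M (\<lambda>\<omega>. poly h (X \<omega>))" "integrable Z (poly h)"
    and "(\<integral>\<omega>. poly h (X \<omega>) \<partial>M) = (\<integral>z. poly h z \<partial>Z)"
proof -
  interpret M: prob_space M by fact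
  interpret Z: real_distribution Z by fact
  have [measurable]: "X \<in> borel_measurable M"
    and XM: "\<And>j. j \<le> 2 * m \<Longrightarrow> integrable M (\<lambda>\<omega>. X \<omega> ^ j)"
      "\<And>j. j \<le> 2 * m \<Longrightarrow> (\<integral>\<omega>. X \<omega> ^ j \<partial>M) = (\<integral>z. z ^ j \<partial>Z)"
    using X by (auto simp: moment_class_def)
  show "integrable M (\<lambda>\<omega>. poly h (X \<omega>))"
    using M.integrable_poly_moment[of X m h] XM(1) deg by simp
  show "integrable Z (poly h)"
    using Z.integrable_poly_moment[of "\<lambda>z. z" m h] Z(2) deg by simp
  have Zi: "integrable Z (\<lambda>z. z ^ j)" if "j \<le> 2 * m" for j
    using Z.integrable_poly_moment[of "\<lambda>z. z" m "monom 1 j"] Z(2) that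
    by (simp add: poly_monom degree_monom_eq)
  have "(\<integral>\<omega>. poly h (X \<omega>) \<partial>M) = (\<Sum>j\<le>degree h. coeff h j * (\<integral>\<omega>. X \<omega> ^ j \<partial>M))"
    unfolding poly_altdef using deg XM(1) by (subst Bochner_Integration.integral_sum) auto
  also have "\<dots> = (\<Sum>j\<le>degree h. coeff h j * (\<integral>z. z ^ j \<partial>Z))"
    using deg XM(2) by (intro sum.cong) auto
  also have "\<dots> = (\<integral>z. poly h z \<partial>Z)"
    unfolding poly_altdef using deg Zi by (subst Bochner_Integration.integral_sum) auto
  finally show "(\<integral>\<omega>. poly h (X \<omega>) \<partial>M) = (\<integral>z. poly h z \<partial>Z)" .
qed

text \<open>
  The polynomials are monic of every degree up to \<open>m\<close>, so subtracting a multiple of \<open>p d\<close> from a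
  polynomial of degree \<open>d\<close> lowers its degree.
\<close>

lemma orthogonal_system_lower_degree:
  assumes Z: "real_distribution Z" "integrable Z (\<lambda>z. z ^ (2 * m))"
    and orth: "orthogonal_polynomial_system Z m p"
    and "k \<le> m" "degree h < k"
  shows "(\<integral>z. poly h z * poly (p k) z \<partial>Z) = 0"
proof -
  interpret Z: real_distribution Z by fact
  have deg: "degree (p j) = j" "lead_coeff (p j) = 1" if "j \<le> m" for j
    using orth that by (auto simp: orthogonal_polynomial_system_def)
  have int: "integrable Z (\<lambda>z. poly g z * poly (p k) z)" if "degree g \<le> m" for g
  proof -
    have "degree (g * p k) \<le> 2 * m"
      using that deg(1)[OF \<open>k \<le> m\<close>] \<open>k \<le> m\<close> by (intro order_trans[OF degree_mult_le]) auto
    then show ?thesis using Z.integrable_poly_moment[of "\<lambda>z. z" m "g * p k"] Z(2) by simp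
  qed
  have "\<forall>h. degree h < d \<longrightarrow> (\<integral>z. poly h z * poly (p k) z \<partial>Z) = 0" if "d \<le> k" for d
    using that
  proof (induction d)
    case (Suc d)
    show ?case
    proof (intro allI impI)
      fix h :: "real poly" assume h: "degree h < Suc d"
      define g where "g = h - smult (coeff h d) (p d)"
      have d: "d \<le> m" "d < k" using Suc.prems \<open>k \<le> m\<close> by auto
      have "coeff g d = 0" using deg[OF d(1)] by (simp add: g_def)
      moreover have gd: "degree g \<le> d" unfolding g_def
        using h deg(1)[OF d(1)] by (intro degree_diff_le order_trans[OF degree_smult_le]) auto
      ultimately have "g = 0 \<or> degree g < d" by (rule eq_zero_or_degree_less[rotated])
      then have g0: "(\<integral>z. poly g z * poly (p k) z \<partial>Z) = 0" using Suc by auto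
      have h_eq: "poly h z * poly (p k) z = poly g z * poly (p k) z
          + coeff h d * (poly (p d) z * poly (p k) z)" for z
        by (simp add: g_def algebra_simps)
      have "(\<integral>z. poly (p d) z * poly (p k) z \<partial>Z) = 0"
        using orth d \<open>k \<le> m\<close> by (auto simp: orthogonal_polynomial_system_def)
      then show "(\<integral>z. poly h z * poly (p k) z \<partial>Z) = 0"
        unfolding h_eq using g0 int[of g] int[of "p d"] deg(1)[OF d(1)] d gd
        by (subst Bochner_Integration.integral_add) auto
    qed
  qed simp
  then show ?thesis using assms(5) by blast
qed

lemma orthogonal_system_square:
  assumes Z: "real_distribution Z" "integrable Z (\<lambda>z. z ^ (2 * m))"
    and orth: "orthogonal_polynomial_system Z m p" and k: "k \<le> m"
  shows "(\<integral>z. z ^ k * poly (p k) z \<partial>Z) = (\<integral>z. (poly (p k) z)\<^sup>2 \<partial>Z)"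
proof -
  interpret Z: real_distribution Z by fact
  have deg: "degree (p k) = k" "lead_coeff (p k) = 1"
    using orth k by (auto simp: orthogonal_polynomial_system_def)
  define g where "g = monom 1 k - p k"
  have int: "integrable Z (\<lambda>z. poly g z * poly (p k) z)" if "degree g \<le> k" for g
  proof -
    have "degree (g * p k) \<le> 2 * m"
      using that deg(1) k by (intro order_trans[OF degree_mult_le]) auto
    then show ?thesis using Z.integrable_poly_moment[of "\<lambda>z. z" m "g * p k"] Z(2) by simp
  qed
  have "coeff g k = 0" using deg by (simp add: g_def)
  moreover have gd: "degree g \<le> k" unfolding g_def
    using deg by (intro degree_diff_le) (auto simp: degree_monom_le)
  ultimately have "g = 0 \<or> degree g < k" by (rule eq_zero_or_degree_less[rotated])
  then have g0: "(\<integral>z. poly g z * poly (p k) z \<partial>Z) = 0"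
    using orthogonal_system_lower_degree[OF Z orth k, of g] by auto
  have eq: "z ^ k * poly (p k) z = poly g z * poly (p k) z + (poly (p k) z)\<^sup>2" for z
    by (simp add: g_def poly_monom algebra_simps power2_eq_square)
  show ?thesis unfolding eq using g0 int[OF gd] int[of "p k"] deg
    by (subst Bochner_Integration.integral_add) (auto simp: power2_eq_square)
qed

lemma alpha_pos:
  assumes "real_distribution (L a)" "integrable (L a) (\<lambda>z. z ^ (2 * m))"
    and orth: "orthogonal_polynomial_system (L a) m (P a)" and k: "k \<le> m"
  shows "alpha L P a k > 0" "(\<integral>z. (poly (P a k) z)\<^sup>2 \<partial>L a) = fact k * alpha L P a k"
  using orthogonal_system_square[OF assms] orth k
  by (auto simp: alpha_def orthogonal_polynomial_system_def)

section \<open>Sums and mixtures of independent variables\<close>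

lemma indep_vars_PiM_coordinates:
  assumes I: "I \<noteq> {}" and N: "\<And>i. i \<in> I \<Longrightarrow> real_distribution (N i)"
  shows "prob_space (PiM I N)" "prob_space.indep_vars (PiM I N) (\<lambda>_. borel) (\<lambda>i \<omega>. \<omega> i) I"
    and "\<And>i. i \<in> I \<Longrightarrow> distr (PiM I N) borel (\<lambda>\<omega>. \<omega> i) = N i"
proof -
  have ps: "prob_space (N i)" and sets_N [simp]: "sets (N i) = sets borel" if "i \<in> I" for i
    using N[OF that] by (auto simp: real_distribution_def real_distribution_axioms_def)
  show 1: "prob_space (PiM I N)" using ps by (rule prob_space_PiM)
  interpret prob_space "PiM I N" by fact
  have sets: "sets (PiM I N) = sets (PiM I (\<lambda>_. borel))" by (rule sets_PiM_cong) auto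
  have meas: "(\<lambda>\<omega>. \<omega> i) \<in> borel_measurable (PiM I N)" if "i \<in> I" for i
    using measurable_component_singleton[OF that, of N] measurable_cong_sets[OF refl sets_N[OF that]]
    by blast
  show 3: "distr (PiM I N) borel (\<lambda>\<omega>. \<omega> i) = N i" if "i \<in> I" for i
    using distr_PiM_component[of I N i] ps that
    by (metis distr_cong sets_N)
  have "distr (PiM I N) (PiM I (\<lambda>_. borel)) (\<lambda>\<omega>. \<lambda>i\<in>I. \<omega> i)
      = distr (PiM I N) (PiM I N) (\<lambda>\<omega>. \<omega>)"
    by (rule distr_cong) (auto simp: sets space_PiM PiE_restrict)
  also have "\<dots> = PiM I N" by (rule distr_id)
  also have "\<dots> = PiM I (\<lambda>i. distr (PiM I N) borel (\<lambda>\<omega>. \<omega> i))"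
    by (rule PiM_cong) (auto simp: 3)
  finally show "indep_vars (\<lambda>_. borel) (\<lambda>i \<omega>. \<omega> i) I"
    by (subst indep_vars_iff_distr_eq_PiM'[OF I]) (auto simp: meas)
qed

lemma (in prob_space) distr_sum_closed_family:
  fixes X :: "'i \<Rightarrow> 'a \<Rightarrow> real"
  assumes "closed_under_independent_addition L" "finite A" "A \<noteq> {}"
    and "indep_vars (\<lambda>_. borel) X A"
    and "\<And>i. i \<in> A \<Longrightarrow> a i > 0" "\<And>i. i \<in> A \<Longrightarrow> distr M borel (X i) = L (a i)"
  shows "distr M borel (\<lambda>\<omega>. \<Sum>i\<in>A. X i \<omega>) = L (\<Sum>i\<in>A. a i)"
  using assms(2-)
proof (induction A rule: finite_ne_induct)
  case (singleton i)
  then show ?case by simp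
next
  case (insert i A)
  have ind: "indep_var borel (X i) borel (\<lambda>\<omega>. \<Sum>i\<in>A. X i \<omega>)"
    using insert by (intro indep_vars_sum) auto
  have IH: "distr M borel (\<lambda>\<omega>. \<Sum>i\<in>A. X i \<omega>) = L (\<Sum>i\<in>A. a i)"
    using insert.prems by (intro insert.IH indep_vars_subset[OF insert.prems(1)]) auto
  have "(\<Sum>i\<in>A. a i) > 0" using insert by (intro sum_pos) auto
  have "distr M borel (\<lambda>\<omega>. X i \<omega> + (\<Sum>i\<in>A. X i \<omega>))
      = (distr M borel (X i) \<star> distr M borel (\<lambda>\<omega>. \<Sum>i\<in>A. X i \<omega>))"
    using ind indep_var_rv1[OF ind] indep_var_rv2[OF ind] by (rule sum_indep_random_variable)
  also have "\<dots> = L (a i + (\<Sum>i\<in>A. a i))"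
    using assms(1) insert.prems \<open>(\<Sum>i\<in>A. a i) > 0\<close>
    by (simp add: IH closed_under_independent_addition_def)
  finally show ?case using insert.hyps by simp
qed

lemma multi_index_eqI:
  assumes "\<mu> \<in> multi_indices n j" "\<nu> \<in> multi_indices n k" "\<And>i. i \<in> {1..n} \<Longrightarrow> \<mu> i = \<nu> i"
  shows "\<mu> = \<nu>"
  using assms by (intro PiE_ext[of \<mu> "{1..n}" "\<lambda>_. UNIV" \<nu>]) (auto simp: multi_indices_def)

text \<open>
  Events expressed by \<open>h(f)\<close> are events expressed by \<open>f\<close>. This passes the independence of two
  variables with values in spaces of different types on to functions of them with a common range.
\<close>

lemma sigma_sets_vimage_compose_subset:
  assumes f: "f \<in> measurable N A" and h: "h \<in> measurable A B"
  shows "sigma_sets (space N) {(\<lambda>\<omega>. h (f \<omega>)) -` S \<inter> space N | S. S \<in> sets B}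
    \<subseteq> {f -` T \<inter> space N | T. T \<in> sets A}"
proof -
  have hf: "(\<lambda>\<omega>. h (f \<omega>)) \<in> space N \<rightarrow> space B"
    using measurable_space[OF f] measurable_space[OF h] by auto
  have "sigma_sets (space N) {(\<lambda>\<omega>. h (f \<omega>)) -` S \<inter> space N | S. S \<in> sets B}
      = {(\<lambda>\<omega>. h (f \<omega>)) -` S \<inter> space N | S. S \<in> sets B}"
    using sets_vimage_algebra2[OF hf] sets_vimage_algebra[of "space N" "\<lambda>\<omega>. h (f \<omega>)" B] by simp
  also have "\<dots> \<subseteq> {f -` T \<inter> space N | T. T \<in> sets A}"
  proof safe
    fix S assume "S \<in> sets B"
    then have "h -` S \<inter> space A \<in> sets A" using h by (rule measurable_sets[rotated])
    moreover have "(\<lambda>\<omega>. h (f \<omega>)) -` S \<inter> space N = f -` (h -` S \<inter> space A) \<inter> space N"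
      using measurable_space[OF f] by auto
    ultimately show "\<exists>T. (\<lambda>\<omega>. h (f \<omega>)) -` S \<inter> space N = f -` T \<inter> space N \<and> T \<in> sets A"
      by blast
  qed
  finally show ?thesis .
qed

lemma indep_pair_expectation:
  fixes g :: "'c \<Rightarrow> complex"
  assumes N: "prob_space N" and ind: "indep_pair N (count_space K) I B V" and "\<mu> \<in> K"
    and g: "g \<in> borel_measurable B" "\<And>x. norm (g x) \<le> 1"
  shows "(\<integral>\<omega>. indicator {\<mu>} (I \<omega>) * g (V \<omega>) \<partial>N)
    = measure N {\<omega> \<in> space N. I \<omega> = \<mu>} * (\<integral>\<omega>. g (V \<omega>) \<partial>N)"
proof -
  interpret prob_space N by fact
  have I: "I \<in> measurable N (count_space K)" and V: "V \<in> measurable N B"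
    and ind': "indep_set {I -` S \<inter> space N | S. S \<in> sets (count_space K)}
      {V -` T \<inter> space N | T. T \<in> sets B}"
    using ind by (auto simp: indep_pair_def)
  have h: "(indicator {\<mu>} :: _ \<Rightarrow> complex) \<in> borel_measurable (count_space K)" by simp
  have rI: "(\<lambda>\<omega>. indicator {\<mu>} (I \<omega>) :: complex) \<in> borel_measurable N"
    by (rule measurable_compose[OF I h])
  have rV: "(\<lambda>\<omega>. g (V \<omega>)) \<in> borel_measurable N"
    by (rule measurable_compose[OF V g(1)])
  have "indep_set
      (sigma_sets (space N) {(\<lambda>\<omega>. indicator {\<mu>} (I \<omega>) :: complex) -` S \<inter> space N | S. S \<in> sets borel})
      (sigma_sets (space N) {(\<lambda>\<omega>. g (V \<omega>)) -` S \<inter> space N | S. S \<in> sets borel})"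
    (is "indep_set ?A ?B")
    unfolding indep_set_def
  proof (rule indep_sets_mono_sets[OF ind'[unfolded indep_set_def]])
    fix b
    show "case_bool ?A ?B b \<subseteq> case_bool {I -` S \<inter> space N | S. S \<in> sets (count_space K)}
        {V -` T \<inter> space N | T. T \<in> sets B} b"
      using sigma_sets_vimage_compose_subset[OF I h] sigma_sets_vimage_compose_subset[OF V g(1)]
      by (cases b) (simp_all only: bool.case)
  qed
  then have iv: "indep_var borel (\<lambda>\<omega>. indicator {\<mu>} (I \<omega>) :: complex) borel (\<lambda>\<omega>. g (V \<omega>))"
    unfolding indep_var_eq using rI rV by blast
  have iI: "integrable N (\<lambda>\<omega>. indicator {\<mu>} (I \<omega>) :: complex)"
    by (rule integrable_const_bound[where B = 1]) (use rI in \<open>auto simp: indicator_def\<close>)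
  have iV: "integrable N (\<lambda>\<omega>. g (V \<omega>))"
    by (rule integrable_const_bound[where B = 1]) (use rV g(2) in auto)
  have "(\<integral>\<omega>. indicator {\<mu>} (I \<omega>) * g (V \<omega>) \<partial>N)
      = (\<integral>\<omega>. (indicator {\<mu>} (I \<omega>) :: complex) \<partial>N) * (\<integral>\<omega>. g (V \<omega>) \<partial>N)"
    by (rule indep_var_lebesgue_integral[OF iv iI iV])
  also have "(\<integral>\<omega>. (indicator {\<mu>} (I \<omega>) :: complex) \<partial>N)
      = (\<integral>\<omega>. complex_of_real (indicator {\<omega> \<in> space N. I \<omega> = \<mu>} \<omega>) \<partial>N)"
    by (intro Bochner_Integration.integral_cong) (auto simp: indicator_def)
  also have "\<dots> = complex_of_real (\<integral>\<omega>. indicator {\<omega> \<in> space N. I \<omega> = \<mu>} \<omega> \<partial>N)"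
    by (rule integral_complex_of_real)
  also have "(\<integral>\<omega>. indicator {\<omega> \<in> space N. I \<omega> = \<mu>} \<omega> \<partial>N) = measure N {\<omega> \<in> space N. I \<omega> = \<mu>}"
    by (simp add: Int_absorb2 subset_iff)
  finally show ?thesis .
qed

section \<open>Families of polynomials with an addition identity\<close>

locale additive_polynomial_family =
  fixes m n :: nat
    and L :: "real \<Rightarrow> real measure"
    and P :: "real \<Rightarrow> nat \<Rightarrow> real poly"
    and c :: "(nat \<Rightarrow> nat) \<Rightarrow> real"
    and ls :: "nat \<Rightarrow> real"
  assumes n_pos: "n \<ge> 1"
    and law: "\<And>a. a > 0 \<Longrightarrow> real_distribution (L a)"
    and closed: "closed_under_independent_addition L"
    and moment: "\<And>a. a > 0 \<Longrightarrow> integrable (L a) (\<lambda>z. z ^ (2 * m))"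
    and orth: "\<And>a. a > 0 \<Longrightarrow> orthogonal_polynomial_system (L a) m (P a)"
    and addition: "\<And>(a :: nat \<Rightarrow> real) (x :: nat \<Rightarrow> real). (\<forall>i\<in>{1..n}. a i > 0) \<Longrightarrow>
           poly (P (\<Sum>i\<in>{1..n}. a i) m) (\<Sum>i\<in>{1..n}. x i) =
             (\<Sum>\<mu>\<in>multi_indices n m. c \<mu> * multi_poly P n a \<mu> x)"
    and ls_pos: "\<forall>i\<in>{1..n}. ls i > 0"
begin

abbreviation l :: real where "l \<equiv> \<Sum>i\<in>{1..n}. ls i"

lemma l_pos: "l > 0"
  using n_pos ls_pos by (intro sum_pos) auto

lemma degree_P: "a > 0 \<Longrightarrow> k \<le> m \<Longrightarrow> degree (P a k) = k"
  and lead_coeff_P: "a > 0 \<Longrightarrow> k \<le> m \<Longrightarrow> lead_coeff (P a k) = 1"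
  using orth unfolding orthogonal_polynomial_system_def by blast+

lemma alpha_P_pos: "a > 0 \<Longrightarrow> k \<le> m \<Longrightarrow> alpha L P a k > 0"
  using alpha_pos law moment orth by blast

lemma multi_alpha_pos: "\<mu> \<in> multi_indices n m \<Longrightarrow> multi_alpha L P n ls \<mu> > 0"
  unfolding multi_alpha_def using ls_pos multi_index_le by (intro prod_pos) (auto intro!: alpha_P_pos)

lemma prod_expectation:
  assumes M: "prob_space M" and X: "\<forall>i\<in>{1..n}. X i \<in> moment_class (L (ls i)) m M"
    and ind: "prob_space.indep_vars M (\<lambda>_. borel) X {1..n}"
    and h: "\<And>i. i \<in> {1..n} \<Longrightarrow> degree (h i) \<le> 2 * m"
  shows "integrable M (\<lambda>\<omega>. \<Prod>i\<in>{1..n}. poly (h i) (X i \<omega>))"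
    and "(\<integral>\<omega>. (\<Prod>i\<in>{1..n}. poly (h i) (X i \<omega>)) \<partial>M) = (\<Prod>i\<in>{1..n}. \<integral>z. poly (h i) z \<partial>L (ls i))"
proof -
  interpret M: prob_space M by fact
  have ind': "M.indep_vars (\<lambda>_. borel) (\<lambda>i \<omega>. poly (h i) (X i \<omega>)) {1..n}"
    by (rule M.indep_vars_compose2[OF ind]) measurable
  have int: "integrable M (\<lambda>\<omega>. poly (h i) (X i \<omega>))"
    and eq: "(\<integral>\<omega>. poly (h i) (X i \<omega>) \<partial>M) = (\<integral>z. poly (h i) z \<partial>L (ls i))" if "i \<in> {1..n}" for i
    using moment_class_poly[of "X i" "L (ls i)" m M "h i"] X law moment ls_pos M h that by auto
  show "integrable M (\<lambda>\<omega>. \<Prod>i\<in>{1..n}. poly (h i) (X i \<omega>))"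
    by (rule M.indep_vars_integrable[OF _ ind' int]) auto
  have "(\<integral>\<omega>. (\<Prod>i\<in>{1..n}. poly (h i) (X i \<omega>)) \<partial>M) = (\<Prod>i\<in>{1..n}. \<integral>\<omega>. poly (h i) (X i \<omega>) \<partial>M)"
    by (rule M.indep_vars_lebesgue_integral[OF _ ind' int]) auto
  then show "(\<integral>\<omega>. (\<Prod>i\<in>{1..n}. poly (h i) (X i \<omega>)) \<partial>M) = (\<Prod>i\<in>{1..n}. \<integral>z. poly (h i) z \<partial>L (ls i))"
    using eq by simp
qed

lemma power_sum_expectation:
  assumes MX: "prob_space M" "\<forall>i\<in>{1..n}. X i \<in> moment_class (L (ls i)) m M"
    "prob_space.indep_vars M (\<lambda>_. borel) X {1..n}" and j: "j \<le> 2 * m"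
  shows "integrable M (\<lambda>\<omega>. (\<Sum>i\<in>{1..n}. X i \<omega>) ^ j)"
    and "(\<integral>\<omega>. (\<Sum>i\<in>{1..n}. X i \<omega>) ^ j \<partial>M) = fact j * (\<Sum>\<mu>\<in>multi_indices n j.
          \<Prod>i\<in>{1..n}. \<integral>z. poly (monom (1 / fact (\<mu> i)) (\<mu> i)) z \<partial>L (ls i))"
proof -
  have eq: "(\<Sum>i\<in>{1..n}. X i \<omega>) ^ j = fact j * (\<Sum>\<mu>\<in>multi_indices n j.
      \<Prod>i\<in>{1..n}. poly (monom (1 / fact (\<mu> i)) (\<mu> i)) (X i \<omega>))" for \<omega>
    using multinomial_theorem[where x = "\<lambda>i. X i \<omega>" and n = n and m = j]
    by (simp add: poly_monom field_simps)
  have deg: "degree (monom (1 / fact (\<mu> i)) (\<mu> i) :: real poly) \<le> 2 * m"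
    if "\<mu> \<in> multi_indices n j" "i \<in> {1..n}" for \<mu> i
    using multi_index_le[OF that] j by (intro order_trans[OF degree_monom_le]) simp
  have E: "integrable M (\<lambda>\<omega>. \<Prod>i\<in>{1..n}. poly (monom (1 / fact (\<mu> i)) (\<mu> i)) (X i \<omega>))"
    "(\<integral>\<omega>. (\<Prod>i\<in>{1..n}. poly (monom (1 / fact (\<mu> i)) (\<mu> i)) (X i \<omega>)) \<partial>M)
      = (\<Prod>i\<in>{1..n}. \<integral>z. poly (monom (1 / fact (\<mu> i)) (\<mu> i)) z \<partial>L (ls i))"
    if "\<mu> \<in> multi_indices n j" for \<mu>
    using prod_expectation[OF MX, of "\<lambda>i. monom (1 / fact (\<mu> i)) (\<mu> i)"] deg[OF that] by auto
  show "integrable M (\<lambda>\<omega>. (\<Sum>i\<in>{1..n}. X i \<omega>) ^ j)"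
    unfolding eq by (intro integrable_mult_right Bochner_Integration.integrable_sum E(1))
  show "(\<integral>\<omega>. (\<Sum>i\<in>{1..n}. X i \<omega>) ^ j \<partial>M) = fact j * (\<Sum>\<mu>\<in>multi_indices n j.
          \<Prod>i\<in>{1..n}. \<integral>z. poly (monom (1 / fact (\<mu> i)) (\<mu> i)) z \<partial>L (ls i))"
    unfolding eq using E by (simp add: Bochner_Integration.integral_sum)
qed

text \<open>
  Independent \<open>Z\<^sub>i\<close> with laws \<open>L (ls i)\<close>, realised as coordinates of a product space, serve as a
  reference model: for them the law of the sum is known, and moments of other sums are compared
  with theirs.
\<close>

lemma independent_copies:
  obtains \<Omega> :: "(nat \<Rightarrow> real) measure" and Z
  where "prob_space \<Omega>" "\<forall>i\<in>{1..n}. Z i \<in> moment_class (L (ls i)) m \<Omega>"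
    "prob_space.indep_vars \<Omega> (\<lambda>_. borel) Z {1..n}"
    "distr \<Omega> borel (\<lambda>\<omega>. \<Sum>i\<in>{1..n}. Z i \<omega>) = L l"
proof -
  define \<Omega> where "\<Omega> = PiM {1..n} (\<lambda>i. L (ls i))"
  define Z where "Z = (\<lambda>(i::nat) (\<omega> :: nat \<Rightarrow> real). \<omega> i)"
  have ne: "{1..n} \<noteq> {}" using n_pos by auto
  have rd: "real_distribution (L (ls i))" if "i \<in> {1..n}" for i using law ls_pos that by auto
  note PiM = indep_vars_PiM_coordinates[of "{1..n}" "\<lambda>i. L (ls i)", OF ne rd, folded \<Omega>_def]
  have 1: "prob_space \<Omega>" by (rule PiM(1))
  interpret prob_space \<Omega> by fact
  have 2: "indep_vars (\<lambda>_. borel) Z {1..n}" unfolding Z_def by (rule PiM(2))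
  have 3: "distr \<Omega> borel (Z i) = L (ls i)" if "i \<in> {1..n}" for i
    unfolding Z_def using PiM(3) that by simp
  have meas: "Z i \<in> borel_measurable \<Omega>" if "i \<in> {1..n}" for i
    using 2 that by (simp add: indep_vars_def)
  have "Z i \<in> moment_class (L (ls i)) m \<Omega>" if i: "i \<in> {1..n}" for i
  proof -
    interpret Li: real_distribution "L (ls i)" by (rule rd[OF i])
    have "integrable (L (ls i)) (\<lambda>z. z ^ j)" if "j \<le> 2 * m" for j
      using Li.integrable_poly_moment[of "\<lambda>z. z" m "monom 1 j"] moment[of "ls i"] ls_pos i that
      by (simp add: poly_monom degree_monom_eq)
    then show ?thesis
      using meas[OF i] unfolding moment_class_def 3[OF i, symmetric]
      by (auto simp: integrable_distr_eq integral_distr)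
  qed
  moreover have "distr \<Omega> borel (\<lambda>\<omega>. \<Sum>i\<in>{1..n}. Z i \<omega>) = L l"
    using ls_pos ne by (intro distr_sum_closed_family closed 2 3) auto
  ultimately show ?thesis using that 1 2 by blast
qed

text \<open>
  The moments of a sum of independent variables up to order \<open>2 m\<close> depend only on the moments of the
  summands up to that order, so they agree with those of the reference model.
\<close>

lemma sum_in_moment_class:
  assumes MX: "prob_space M" "\<forall>i\<in>{1..n}. X i \<in> moment_class (L (ls i)) m M"
    "prob_space.indep_vars M (\<lambda>_. borel) X {1..n}"
  shows "(\<lambda>\<omega>. \<Sum>i\<in>{1..n}. X i \<omega>) \<in> moment_class (L l) m M"
proof -
  obtain \<Omega> :: "(nat \<Rightarrow> real) measure" and Z where \<Omega>: "prob_space \<Omega>"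
    "\<forall>i\<in>{1..n}. Z i \<in> moment_class (L (ls i)) m \<Omega>"
    "prob_space.indep_vars \<Omega> (\<lambda>_. borel) Z {1..n}"
    and sum: "distr \<Omega> borel (\<lambda>\<omega>. \<Sum>i\<in>{1..n}. Z i \<omega>) = L l"
    using independent_copies by blast
  have Xm: "(\<lambda>\<omega>. \<Sum>i\<in>{1..n}. X i \<omega>) \<in> borel_measurable M"
    using MX(2) by (intro borel_measurable_sum) (auto simp: moment_class_def)
  have Zm: "(\<lambda>\<omega>. \<Sum>i\<in>{1..n}. Z i \<omega>) \<in> borel_measurable \<Omega>"
    using \<Omega>(2) by (intro borel_measurable_sum) (auto simp: moment_class_def)
  have "(\<integral>\<omega>. (\<Sum>i\<in>{1..n}. X i \<omega>) ^ j \<partial>M) = (\<integral>z. z ^ j \<partial>L l)" if "j \<le> 2 * m" for j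
  proof -
    have "(\<integral>z. z ^ j \<partial>L l) = (\<integral>\<omega>. (\<Sum>i\<in>{1..n}. Z i \<omega>) ^ j \<partial>\<Omega>)"
      unfolding sum[symmetric] by (rule integral_distr[OF Zm]) measurable
    then show ?thesis
      unfolding power_sum_expectation(2)[OF MX that] power_sum_expectation(2)[OF \<Omega> that] by simp
  qed
  then show ?thesis
    using Xm power_sum_expectation(1)[OF MX] by (auto simp: moment_class_def)
qed

text \<open>
  Among the monomials \<open>x\<^sup>\<mu>\<close> occurring in \<open>P l m\<close> of the sum, those with \<open>\<mu> i < \<nu> i\<close> for some
  \<open>i\<close> are orthogonal to \<open>P\<^sup>\<nu>\<close>. As the total degree of \<open>\<mu>\<close> is at most \<open>m\<close>, only \<open>\<mu> = \<nu>\<close> is left.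
\<close>

lemma expectation_sum_poly_mult_multi_poly:
  assumes MX: "prob_space M" "\<forall>i\<in>{1..n}. X i \<in> moment_class (L (ls i)) m M"
    "prob_space.indep_vars M (\<lambda>_. borel) X {1..n}" and \<nu>: "\<nu> \<in> multi_indices n m"
  shows "(\<integral>\<omega>. poly (P l m) (\<Sum>i\<in>{1..n}. X i \<omega>) * multi_poly P n ls \<nu> (\<lambda>i. X i \<omega>) \<partial>M)
    = fact m * multi_alpha L P n ls \<nu>"
proof -
  define h where "h \<mu> i = monom (1 / fact (\<mu> i)) (\<mu> i) * P (ls i) (\<nu> i)" for \<mu> :: "nat \<Rightarrow> nat" and i
  define E where "E \<mu> = (\<Prod>i\<in>{1..n}. \<integral>z. poly (h \<mu> i) z \<partial>L (ls i))" for \<mu>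
  have \<nu>i: "\<nu> i \<le> m" "ls i > 0" if "i \<in> {1..n}" for i
    using multi_index_le[OF \<nu>] ls_pos that by auto
  have deg: "degree (h \<mu> i) \<le> 2 * m" if "j \<le> m" "\<mu> \<in> multi_indices n j" "i \<in> {1..n}" for \<mu> i j
  proof -
    have "degree (h \<mu> i) \<le> \<mu> i + \<nu> i" unfolding h_def
      using degree_P \<nu>i that(3)
      by (intro order_trans[OF degree_mult_le] add_mono degree_monom_le) auto
    then show ?thesis using multi_index_le[OF that(2,3)] \<nu>i(1)[OF that(3)] that(1) by linarith
  qed
  have expand: "poly (P l m) (\<Sum>i\<in>{1..n}. X i \<omega>) * multi_poly P n ls \<nu> (\<lambda>i. X i \<omega>)
      = (\<Sum>j\<le>m. coeff (P l m) j * fact j *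
          (\<Sum>\<mu>\<in>multi_indices n j. \<Prod>i\<in>{1..n}. poly (h \<mu> i) (X i \<omega>)))" for \<omega>
  proof -
    have pow: "(\<Sum>i\<in>{1..n}. X i \<omega>) ^ j
        = fact j * (\<Sum>\<mu>\<in>multi_indices n j. \<Prod>i\<in>{1..n}. X i \<omega> ^ \<mu> i / fact (\<mu> i))" for j
      using multinomial_theorem[where x = "\<lambda>i. X i \<omega>" and n = n and m = j]
      by (simp add: field_simps)
    show ?thesis
      unfolding poly_altdef[of "P l m"] degree_P[OF l_pos order_refl] pow multi_poly_def h_def
      by (simp add: poly_monom sum_distrib_right mult.assoc prod.distrib[symmetric])
  qed
  have zero: "E \<mu> = 0" if j: "j \<le> m" "\<mu> \<in> multi_indices n j" and ne: "\<mu> \<noteq> \<nu>" for \<mu> j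
  proof -
    have "\<exists>i\<in>{1..n}. \<mu> i < \<nu> i"
    proof (rule ccontr)
      assume "\<not> ?thesis"
      then have ge: "\<nu> i \<le> \<mu> i" if "i \<in> {1..n}" for i using that by (simp add: not_less)
      have "(\<Sum>i\<in>{1..n}. \<mu> i) \<le> (\<Sum>i\<in>{1..n}. \<nu> i)" using j \<nu> by (simp add: multi_indices_def)
      then have "\<mu> i = \<nu> i" if i: "i \<in> {1..n}" for i
      proof -
        have "(\<Sum>i\<in>{1..n}. \<nu> i) = (\<Sum>i\<in>{1..n}. \<mu> i)"
          using \<open>(\<Sum>i\<in>{1..n}. \<mu> i) \<le> (\<Sum>i\<in>{1..n}. \<nu> i)\<close> ge by (meson le_antisym sum_mono)
        then show ?thesis using sum_mono_inv[of \<nu> "{1..n}" \<mu> i] ge i by simp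
      qed
      then have "\<mu> = \<nu>" using multi_index_eqI[OF j(2) \<nu>] by blast
      then show False using ne by simp
    qed
    then obtain i where i: "i \<in> {1..n}" "\<mu> i < \<nu> i" by blast
    have "(\<integral>z. poly (h \<mu> i) z \<partial>L (ls i)) = 0"
      unfolding h_def poly_mult using i \<nu>i[OF i(1)]
      by (intro orthogonal_system_lower_degree[OF law moment orth])
        (auto intro: le_less_trans[OF degree_monom_le])
    then show ?thesis unfolding E_def using i(1) by (auto intro: prod_zero)
  qed
  have E\<nu>: "E \<nu> = multi_alpha L P n ls \<nu>"
    by (simp add: E_def h_def multi_alpha_def alpha_def poly_monom)
  have "(\<integral>\<omega>. poly (P l m) (\<Sum>i\<in>{1..n}. X i \<omega>) * multi_poly P n ls \<nu> (\<lambda>i. X i \<omega>) \<partial>M)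
      = (\<Sum>j\<le>m. coeff (P l m) j * fact j * (\<Sum>\<mu>\<in>multi_indices n j. E \<mu>))"
    unfolding expand E_def using prod_expectation[OF MX deg]
    by (simp add: Bochner_Integration.integral_sum)
  also have "\<dots> = (\<Sum>j\<le>m. if j = m then fact m * E \<nu> else 0)"
  proof (intro sum.cong refl)
    fix j assume j: "j \<in> {..m}"
    show "coeff (P l m) j * fact j * (\<Sum>\<mu>\<in>multi_indices n j. E \<mu>)
        = (if j = m then fact m * E \<nu> else 0)"
    proof (cases "j = m")
      case True
      have "(\<Sum>\<mu>\<in>multi_indices n m. E \<mu>) = (\<Sum>\<mu>\<in>{\<nu>}. E \<mu>)"
        using \<nu> zero[OF order_refl] by (intro sum.mono_neutral_right finite_multi_indices) auto
      then show ?thesis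
        using True lead_coeff_P[OF l_pos order_refl] degree_P[OF l_pos order_refl] by simp
    next
      case False
      have "\<nu> \<notin> multi_indices n j" using False \<nu> by (auto simp: multi_indices_def)
      then have "(\<Sum>\<mu>\<in>multi_indices n j. E \<mu>) = 0" using zero j by (intro sum.neutral) auto
      then show ?thesis using False by simp
    qed
  qed
  also have "\<dots> = fact m * multi_alpha L P n ls \<nu>" by (simp add: E\<nu>)
  finally show ?thesis .
qed

text \<open>
  The addition identity expands the expectation of the preceding lemma in the orthogonal products
  \<open>P\<^sup>\<mu>\<close>, of which only \<open>\<mu> = \<nu>\<close> contributes; comparison of the two values determines \<open>c \<nu>\<close>.
\<close>

lemma weight_eq_multinomial:
  assumes \<nu>: "\<nu> \<in> multi_indices n m"
  shows "c \<nu> * (\<Prod>i\<in>{1..n}. fact (\<nu> i)) = fact m"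
proof -
  obtain \<Omega> :: "(nat \<Rightarrow> real) measure" and Z where \<Omega>: "prob_space \<Omega>"
    "\<forall>i\<in>{1..n}. Z i \<in> moment_class (L (ls i)) m \<Omega>"
    "prob_space.indep_vars \<Omega> (\<lambda>_. borel) Z {1..n}"
    using independent_copies by blast
  define h where "h \<mu> i = P (ls i) (\<mu> i) * P (ls i) (\<nu> i)" for \<mu> :: "nat \<Rightarrow> nat" and i
  define E where "E \<mu> = (\<Prod>i\<in>{1..n}. \<integral>z. poly (h \<mu> i) z \<partial>L (ls i))" for \<mu>
  have deg: "degree (h \<mu> i) \<le> 2 * m" if "\<mu> \<in> multi_indices n m" "i \<in> {1..n}" for \<mu> i
    unfolding h_def using degree_P ls_pos that multi_index_le[OF that] multi_index_le[OF \<nu> that(2)]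
    by (intro order_trans[OF degree_mult_le]) auto
  have zero: "E \<mu> = 0" if \<mu>: "\<mu> \<in> multi_indices n m" "\<mu> \<noteq> \<nu>" for \<mu>
  proof -
    have "\<mu> = \<nu>" if "\<forall>i\<in>{1..n}. \<mu> i = \<nu> i"
      using multi_index_eqI[OF \<mu>(1) \<nu>] that by blast
    then obtain i where i: "i \<in> {1..n}" "\<mu> i \<noteq> \<nu> i" using \<mu>(2) by blast
    have "(\<integral>z. poly (h \<mu> i) z \<partial>L (ls i)) = 0"
      using orth[of "ls i"] ls_pos i multi_index_le[OF \<mu>(1) i(1)] multi_index_le[OF \<nu> i(1)]
      by (auto simp: h_def orthogonal_polynomial_system_def)
    then show ?thesis unfolding E_def using i(1) by (auto intro: prod_zero)
  qed
  have "(\<integral>z. poly (h \<nu> i) z \<partial>L (ls i)) = fact (\<nu> i) * alpha L P (ls i) (\<nu> i)" if i: "i \<in> {1..n}" for i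
  proof -
    have a: "ls i > 0" using ls_pos i by simp
    show ?thesis
      using alpha_pos(2)[of L "ls i" m P, OF law[OF a] moment[OF a] orth[OF a] multi_index_le[OF \<nu> i]]
      by (simp add: h_def power2_eq_square)
  qed
  then have E\<nu>: "E \<nu> = (\<Prod>i\<in>{1..n}. fact (\<nu> i)) * multi_alpha L P n ls \<nu>"
    by (simp add: E_def multi_alpha_def prod.distrib)
  have "fact m * multi_alpha L P n ls \<nu>
      = (\<integral>\<omega>. poly (P l m) (\<Sum>i\<in>{1..n}. Z i \<omega>) * multi_poly P n ls \<nu> (\<lambda>i. Z i \<omega>) \<partial>\<Omega>)"
    using expectation_sum_poly_mult_multi_poly[OF \<Omega> \<nu>] by simp
  also have "\<dots> = (\<integral>\<omega>. (\<Sum>\<mu>\<in>multi_indices n m. c \<mu> * (\<Prod>i\<in>{1..n}. poly (h \<mu> i) (Z i \<omega>))) \<partial>\<Omega>)"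
    unfolding addition[OF ls_pos] multi_poly_def h_def
    by (simp add: sum_distrib_right prod.distrib mult.assoc)
  also have "\<dots> = (\<Sum>\<mu>\<in>multi_indices n m. c \<mu> * E \<mu>)"
    unfolding E_def using prod_expectation[OF \<Omega> deg] by (simp add: Bochner_Integration.integral_sum)
  also have "\<dots> = (\<Sum>\<mu>\<in>{\<nu>}. c \<mu> * E \<mu>)"
    using \<nu> zero by (intro sum.mono_neutral_right finite_multi_indices) auto
  finally show ?thesis using multi_alpha_pos[OF \<nu>] by (simp add: E\<nu>)
qed

lemma weight_pos: "\<nu> \<in> multi_indices n m \<Longrightarrow> c \<nu> > 0"
proof -
  assume "\<nu> \<in> multi_indices n m"
  moreover have "(\<Prod>i\<in>{1..n}. fact (\<nu> i) :: real) > 0" by (intro prod_pos) simp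
  ultimately show "c \<nu> > 0"
    using weight_eq_multinomial by (metis fact_gt_zero zero_less_mult_pos2)
qed

text \<open>
  One factor of the squared polynomial is expanded by the addition identity.
\<close>

lemma alpha_sum:
  "alpha L P l m = (\<Sum>\<mu>\<in>multi_indices n m. c \<mu> * multi_alpha L P n ls \<mu>)"
proof -
  obtain \<Omega> :: "(nat \<Rightarrow> real) measure" and Z where \<Omega>: "prob_space \<Omega>"
    "\<forall>i\<in>{1..n}. Z i \<in> moment_class (L (ls i)) m \<Omega>"
    "prob_space.indep_vars \<Omega> (\<lambda>_. borel) Z {1..n}"
    and sum: "distr \<Omega> borel (\<lambda>\<omega>. \<Sum>i\<in>{1..n}. Z i \<omega>) = L l"
    using independent_copies by blast
  define W where "W \<omega> = (\<Sum>i\<in>{1..n}. Z i \<omega>)" for \<omega>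
  have W [measurable]: "W \<in> borel_measurable \<Omega>" unfolding W_def[abs_def]
    using \<Omega>(2) by (intro borel_measurable_sum) (auto simp: moment_class_def)
  interpret prob_space \<Omega> by fact
  have WM: "W \<in> moment_class (L l) m \<Omega>" unfolding W_def[abs_def] by (rule sum_in_moment_class[OF \<Omega>])
  have int: "integrable \<Omega> (\<lambda>\<omega>. poly (P l m) (W \<omega>) * multi_poly P n ls \<mu> (\<lambda>i. Z i \<omega>))"
    if \<mu>: "\<mu> \<in> multi_indices n m" for \<mu>
  proof (rule Bochner_Integration.integrable_bound)
    have "degree (P (ls i) (\<mu> i) * P (ls i) (\<mu> i)) \<le> 2 * m" if "i \<in> {1..n}" for i
      using degree_P ls_pos that multi_index_le[OF \<mu> that]
      by (intro order_trans[OF degree_mult_le]) auto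
    from prod_expectation(1)[OF \<Omega> this]
    have 1: "integrable \<Omega> (\<lambda>\<omega>. (multi_poly P n ls \<mu> (\<lambda>i. Z i \<omega>))\<^sup>2)"
      by (simp add: multi_poly_def power2_eq_square prod.distrib)
    have "degree (P l m * P l m) \<le> 2 * m"
      using degree_P[OF l_pos order_refl] by (intro order_trans[OF degree_mult_le]) auto
    from moment_class_poly(1)[OF WM law[OF l_pos] moment[OF l_pos] \<Omega>(1) this]
    have 2: "integrable \<Omega> (\<lambda>\<omega>. (poly (P l m) (W \<omega>))\<^sup>2)" by (simp add: power2_eq_square)
    show "integrable \<Omega> (\<lambda>\<omega>. (poly (P l m) (W \<omega>))\<^sup>2 + (multi_poly P n ls \<mu> (\<lambda>i. Z i \<omega>))\<^sup>2)"
      using 1 2 by simp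
    have [measurable]: "Z i \<in> borel_measurable \<Omega>" if "i \<in> {1..n}" for i
      using \<Omega>(2) that by (auto simp: moment_class_def)
    show "(\<lambda>\<omega>. poly (P l m) (W \<omega>) * multi_poly P n ls \<mu> (\<lambda>i. Z i \<omega>)) \<in> borel_measurable \<Omega>"
      unfolding multi_poly_def by measurable
    have "\<bar>a * b\<bar> \<le> a\<^sup>2 + b\<^sup>2" for a b :: real
      using sum_squares_bound[of "\<bar>a\<bar>" "\<bar>b\<bar>"] mult_nonneg_nonneg[of "\<bar>a\<bar>" "\<bar>b\<bar>"]
      unfolding abs_mult power2_abs by linarith
    then show "AE \<omega> in \<Omega>. norm (poly (P l m) (W \<omega>) * multi_poly P n ls \<mu> (\<lambda>i. Z i \<omega>))
        \<le> norm ((poly (P l m) (W \<omega>))\<^sup>2 + (multi_poly P n ls \<mu> (\<lambda>i. Z i \<omega>))\<^sup>2)"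
      by simp
  qed
  have "fact m * alpha L P l m = (\<integral>z. (poly (P l m) z)\<^sup>2 \<partial>L l)"
    using alpha_pos(2)[of L l m P m, OF law[OF l_pos] moment[OF l_pos] orth[OF l_pos] order_refl] by simp
  also have "\<dots> = (\<integral>\<omega>. (poly (P l m) (W \<omega>))\<^sup>2 \<partial>\<Omega>)"
    unfolding sum[symmetric] W_def[symmetric] by (subst integral_distr) auto
  also have "\<dots> = (\<integral>\<omega>. (\<Sum>\<mu>\<in>multi_indices n m.
      c \<mu> * (poly (P l m) (W \<omega>) * multi_poly P n ls \<mu> (\<lambda>i. Z i \<omega>))) \<partial>\<Omega>)"
  proof (intro Bochner_Integration.integral_cong refl)
    fix \<omega>
    have "poly (P l m) (W \<omega>) = (\<Sum>\<mu>\<in>multi_indices n m. c \<mu> * multi_poly P n ls \<mu> (\<lambda>i. Z i \<omega>))"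
      unfolding W_def by (rule addition[OF ls_pos])
    then have "(poly (P l m) (W \<omega>))\<^sup>2 = poly (P l m) (W \<omega>) *
        (\<Sum>\<mu>\<in>multi_indices n m. c \<mu> * multi_poly P n ls \<mu> (\<lambda>i. Z i \<omega>))"
      by (simp add: power2_eq_square)
    then show "(poly (P l m) (W \<omega>))\<^sup>2 = (\<Sum>\<mu>\<in>multi_indices n m.
      c \<mu> * (poly (P l m) (W \<omega>) * multi_poly P n ls \<mu> (\<lambda>i. Z i \<omega>)))"
      by (simp add: sum_distrib_left mult_ac)
  qed
  also have "\<dots> = (\<Sum>\<mu>\<in>multi_indices n m. c \<mu> * (fact m * multi_alpha L P n ls \<mu>))"
    using int expectation_sum_poly_mult_multi_poly[OF \<Omega>]
    by (simp add: Bochner_Integration.integral_sum W_def)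
  also have "\<dots> = fact m * (\<Sum>\<mu>\<in>multi_indices n m. c \<mu> * multi_alpha L P n ls \<mu>)"
    by (simp add: sum_distrib_left mult_ac)
  finally show ?thesis by simp
qed

abbreviation weight :: "(nat \<Rightarrow> nat) \<Rightarrow> real" where
  "weight \<mu> \<equiv> c \<mu> * (multi_alpha L P n ls \<mu> / alpha L P l m)"

lemma weight_pmf:
  "\<exists>J :: (nat \<Rightarrow> nat) pmf. set_pmf J \<subseteq> multi_indices n m \<and>
     (\<forall>\<mu>\<in>multi_indices n m. pmf J \<mu> = weight \<mu>)"
proof -
  define f where "f \<mu> = (if \<mu> \<in> multi_indices n m then weight \<mu> else 0)" for \<mu>
  have a: "alpha L P l m > 0" using alpha_P_pos[OF l_pos order_refl] .
  have f0: "0 \<le> f \<mu>" for \<mu>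
    using weight_pos multi_alpha_pos a by (auto simp: f_def intro!: mult_nonneg_nonneg less_imp_le)
  have "(\<Sum>\<mu>\<in>multi_indices n m. weight \<mu>) = 1"
    unfolding times_divide_eq_right sum_divide_distrib[symmetric] alpha_sum[symmetric]
    using a by simp
  then have s: "(\<Sum>\<mu>\<in>multi_indices n m. f \<mu>) = 1" by (simp add: f_def)
  have "(\<integral>\<^sup>+\<mu>. f \<mu> \<partial>count_space UNIV) = (\<Sum>\<mu>\<in>multi_indices n m. ennreal (f \<mu>))"
    by (rule nn_integral_count_space'[OF finite_multi_indices]) (auto simp: f_def)
  also have "\<dots> = 1" using f0 s by (simp add: sum_ennreal)
  finally have nn: "(\<integral>\<^sup>+\<mu>. f \<mu> \<partial>count_space UNIV) = 1" .
  have "pmf (embed_pmf f) \<mu> = f \<mu>" for \<mu> using f0 nn by (intro pmf_embed_pmf) auto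
  then show ?thesis
    by (intro exI[of _ "embed_pmf f"]) (auto simp: set_pmf_eq f_def split: if_splits)
qed

text \<open>
  Both the addition identity and the exponential factorise over the summands.
\<close>

lemma iexp_expectation_of_sum:
  assumes M: "prob_space M" and X: "\<forall>i\<in>{1..n}. X i \<in> moment_class (L (ls i)) m M"
    and ind: "prob_space.indep_vars M (\<lambda>_. borel) X {1..n}"
  shows "(\<integral>\<omega>. poly (P l m) (\<Sum>i\<in>{1..n}. X i \<omega>) * iexp (t * (\<Sum>i\<in>{1..n}. X i \<omega>)) \<partial>M)
    = (\<Sum>\<mu>\<in>multi_indices n m. c \<mu> *
        (\<Prod>i\<in>{1..n}. \<integral>\<omega>. poly (P (ls i) (\<mu> i)) (X i \<omega>) * iexp (t * X i \<omega>) \<partial>M))"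
proof -
  interpret prob_space M by fact
  define f where "f \<mu> i x = complex_of_real (poly (P (ls i) (\<mu> i)) x) * iexp (t * x)" for \<mu> i x
  have f_meas [measurable]: "f \<mu> i \<in> borel_measurable borel" for \<mu> i
    unfolding f_def[abs_def] by measurable
  have Xm [measurable]: "X i \<in> borel_measurable M" if "i \<in> {1..n}" for i
    using X that by (auto simp: moment_class_def)
  have int: "integrable M (\<lambda>\<omega>. f \<mu> i (X i \<omega>))" if "\<mu> \<in> multi_indices n m" "i \<in> {1..n}" for \<mu> i
  proof (rule Bochner_Integration.integrable_bound)
    have a: "ls i > 0" using ls_pos that by simp
    have "degree (P (ls i) (\<mu> i)) \<le> 2 * m" using degree_P[OF a] multi_index_le[OF that] by simp
    then show "integrable M (\<lambda>\<omega>. poly (P (ls i) (\<mu> i)) (X i \<omega>))"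
      using moment_class_poly(1)[OF _ law[OF a] moment[OF a] M] X that by auto
    show "(\<lambda>\<omega>. f \<mu> i (X i \<omega>)) \<in> borel_measurable M"
      using measurable_compose[OF Xm[OF that(2)] f_meas] .
  qed (auto simp: f_def norm_mult)
  have ind': "indep_vars (\<lambda>_. borel) (\<lambda>i \<omega>. f \<mu> i (X i \<omega>)) {1..n}" for \<mu>
    by (rule indep_vars_compose2[OF ind]) simp
  have "poly (P l m) (\<Sum>i\<in>{1..n}. X i \<omega>) * iexp (t * (\<Sum>i\<in>{1..n}. X i \<omega>))
      = (\<Sum>\<mu>\<in>multi_indices n m. c \<mu> * (\<Prod>i\<in>{1..n}. f \<mu> i (X i \<omega>)))" for \<omega>
  proof -
    have "iexp (t * (\<Sum>i\<in>{1..n}. X i \<omega>)) = (\<Prod>i\<in>{1..n}. iexp (t * X i \<omega>))"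
      by (simp add: exp_sum[symmetric] sum_distrib_left)
    then show ?thesis
      unfolding addition[OF ls_pos] multi_poly_def f_def
      by (simp add: sum_distrib_right prod.distrib mult.assoc)
  qed
  then have "(\<integral>\<omega>. poly (P l m) (\<Sum>i\<in>{1..n}. X i \<omega>) * iexp (t * (\<Sum>i\<in>{1..n}. X i \<omega>)) \<partial>M)
      = (\<integral>\<omega>. (\<Sum>\<mu>\<in>multi_indices n m. c \<mu> * (\<Prod>i\<in>{1..n}. f \<mu> i (X i \<omega>))) \<partial>M)"
    by simp
  also have "\<dots> = (\<Sum>\<mu>\<in>multi_indices n m. c \<mu> * (\<integral>\<omega>. (\<Prod>i\<in>{1..n}. f \<mu> i (X i \<omega>)) \<partial>M))"
    using indep_vars_integrable[OF _ ind' int]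
    by (subst Bochner_Integration.integral_sum) auto
  also have "\<dots> = (\<Sum>\<mu>\<in>multi_indices n m. c \<mu> * (\<Prod>i\<in>{1..n}. \<integral>\<omega>. f \<mu> i (X i \<omega>) \<partial>M))"
    using indep_vars_lebesgue_integral[OF _ ind' int] by (intro sum.cong) auto
  finally show ?thesis by (simp add: f_def)
qed

text \<open>
  In the following context \<open>Y i k\<close> stands for the variable \<open>X\<^sub>i\<close> biased to order \<open>k\<close>, and \<open>I\<close> is the
  random multi-index.
\<close>

context
  fixes N :: "'b measure" and Y :: "nat \<Rightarrow> nat \<Rightarrow> 'b \<Rightarrow> real" and I :: "'b \<Rightarrow> nat \<Rightarrow> nat"
  assumes N: "prob_space N"
    and Y: "\<And>i k. i \<in> {1..n} \<Longrightarrow> k \<le> m \<Longrightarrow> Y i k \<in> borel_measurable N"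
    and Y_indep: "\<And>\<kappa>. \<kappa> \<in> {1..n} \<rightarrow> {0..m} \<Longrightarrow>
           prob_space.indep_vars N (\<lambda>_. borel) (\<lambda>i. Y i (\<kappa> i)) {1..n}"
    and I_weight: "\<And>\<mu>. \<mu> \<in> multi_indices n m \<Longrightarrow>
           measure N {\<omega> \<in> space N. I \<omega> = \<mu>} = weight \<mu>"
    and I_indep: "indep_pair N (count_space (multi_indices n m)) I
          (PiM ({1..n} \<times> {0..m}) (\<lambda>_. borel :: real measure))
          (\<lambda>\<omega>. \<lambda>p\<in>{1..n} \<times> {0..m}. Y (fst p) (snd p) \<omega>)"
begin

lemma I_measurable: "I \<in> measurable N (count_space (multi_indices n m))"
  using I_indep by (simp add: indep_pair_def)

lemma mixture_split:
  fixes G :: "real \<Rightarrow> 'c :: {semiring_1, t2_space}"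
  assumes "\<omega> \<in> space N"
  shows "G (\<Sum>i\<in>{1..n}. Y i (I \<omega> i) \<omega>)
    = (\<Sum>\<mu>\<in>multi_indices n m. indicator {\<mu>} (I \<omega>) * G (\<Sum>i\<in>{1..n}. Y i (\<mu> i) \<omega>))"
proof -
  have mem: "I \<omega> \<in> multi_indices n m"
    using measurable_space[OF I_measurable assms] by simp
  have "(\<Sum>\<mu>\<in>multi_indices n m. indicator {\<mu>} (I \<omega>) * G (\<Sum>i\<in>{1..n}. Y i (\<mu> i) \<omega>))
      = (\<Sum>\<mu>\<in>{I \<omega>}. indicator {\<mu>} (I \<omega>) * G (\<Sum>i\<in>{1..n}. Y i (\<mu> i) \<omega>))"
    using mem
    by (intro sum.mono_neutral_right finite_multi_indices) (auto simp: indicator_def split: if_splits)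
  then show ?thesis by simp
qed

lemma component_sum_measurable:
  "\<mu> \<in> multi_indices n m \<Longrightarrow> (\<lambda>\<omega>. \<Sum>i\<in>{1..n}. Y i (\<mu> i) \<omega>) \<in> borel_measurable N"
  using multi_index_le by (intro borel_measurable_sum Y) auto

lemma mixture_measurable: "(\<lambda>\<omega>. \<Sum>i\<in>{1..n}. Y i (I \<omega> i) \<omega>) \<in> borel_measurable N"
proof -
  have "(\<lambda>\<omega>. indicator {\<mu>} (I \<omega>) :: real) \<in> borel_measurable N" for \<mu>
    by (rule measurable_compose[OF I_measurable]) simp
  then have "(\<lambda>\<omega>. \<Sum>\<mu>\<in>multi_indices n m. indicator {\<mu>} (I \<omega>) * (\<Sum>i\<in>{1..n}. Y i (\<mu> i) \<omega>))
      \<in> borel_measurable N"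
    by (intro borel_measurable_sum[of "multi_indices n m"] borel_measurable_times
        component_sum_measurable)
  then show ?thesis
    by (rule measurable_cong[THEN iffD1, rotated]) (use mixture_split[where G = "\<lambda>x. x"] in simp)
qed

text \<open>
  Conditioning on the value of \<open>I\<close>, written as a decomposition into indicators.
\<close>

lemma mixture_iexp:
  "(\<integral>\<omega>. iexp (t * (\<Sum>i\<in>{1..n}. Y i (I \<omega> i) \<omega>)) \<partial>N)
    = (\<Sum>\<mu>\<in>multi_indices n m. weight \<mu> * (\<Prod>i\<in>{1..n}. \<integral>\<omega>. iexp (t * Y i (\<mu> i) \<omega>) \<partial>N))"
proof -
  interpret prob_space N by (rule N)
  have I01: "(\<lambda>\<omega>. indicator {\<mu>} (I \<omega>) :: complex) \<in> borel_measurable N" for \<mu>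
    by (rule measurable_compose[OF I_measurable]) simp
  have int: "integrable N (\<lambda>\<omega>. indicator {\<mu>} (I \<omega>) * iexp (t * (\<Sum>i\<in>{1..n}. Y i (\<mu> i) \<omega>)))"
    if "\<mu> \<in> multi_indices n m" for \<mu>
  proof (rule integrable_const_bound[where B = 1])
    show "(\<lambda>\<omega>. indicator {\<mu>} (I \<omega>) * iexp (t * (\<Sum>i\<in>{1..n}. Y i (\<mu> i) \<omega>))) \<in> borel_measurable N"
      using I01 component_sum_measurable[OF that] by measurable
  qed (auto simp: norm_mult indicator_def)
  have summand: "(\<integral>\<omega>. indicator {\<mu>} (I \<omega>) * iexp (t * (\<Sum>i\<in>{1..n}. Y i (\<mu> i) \<omega>)) \<partial>N)
      = weight \<mu> * (\<Prod>i\<in>{1..n}. \<integral>\<omega>. iexp (t * Y i (\<mu> i) \<omega>) \<partial>N)"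
    if \<mu>: "\<mu> \<in> multi_indices n m" for \<mu>
  proof -
    define g where "g x = iexp (t * (\<Sum>i\<in>{1..n}. x (i, \<mu> i)))" for x :: "nat \<times> nat \<Rightarrow> real"
    have \<mu>le: "\<mu> i \<le> m" if "i \<in> {1..n}" for i using multi_index_le[OF \<mu> that] .
    have "(\<lambda>x. \<Sum>i\<in>{1..n}. x (i, \<mu> i))
        \<in> borel_measurable (PiM ({1..n} \<times> {0..m}) (\<lambda>_. borel :: real measure))"
      using \<mu>le by (intro borel_measurable_sum measurable_component_singleton) auto
    then have g: "g \<in> borel_measurable (PiM ({1..n} \<times> {0..m}) (\<lambda>_. borel :: real measure))"
      unfolding g_def by measurable
    have gV: "g (\<lambda>p\<in>{1..n} \<times> {0..m}. Y (fst p) (snd p) \<omega>) = iexp (t * (\<Sum>i\<in>{1..n}. Y i (\<mu> i) \<omega>))"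
      for \<omega>
    proof -
      have "(\<Sum>i\<in>{1..n}. (\<lambda>p\<in>{1..n} \<times> {0..m}. Y (fst p) (snd p) \<omega>) (i, \<mu> i)) = (\<Sum>i\<in>{1..n}. Y i (\<mu> i) \<omega>)"
        using \<mu>le by (intro sum.cong) auto
      then show ?thesis by (simp only: g_def)
    qed
    have "(\<integral>\<omega>. indicator {\<mu>} (I \<omega>) * iexp (t * (\<Sum>i\<in>{1..n}. Y i (\<mu> i) \<omega>)) \<partial>N)
        = weight \<mu> * (\<integral>\<omega>. iexp (t * (\<Sum>i\<in>{1..n}. Y i (\<mu> i) \<omega>)) \<partial>N)"
      using indep_pair_expectation[OF N I_indep \<mu> g] unfolding gV I_weight[OF \<mu>]
      by (simp add: g_def)
    also have "(\<integral>\<omega>. iexp (t * (\<Sum>i\<in>{1..n}. Y i (\<mu> i) \<omega>)) \<partial>N)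
        = char (distr N borel (\<lambda>\<omega>. \<Sum>i\<in>{1..n}. Y i (\<mu> i) \<omega>)) t"
      unfolding char_def using component_sum_measurable[OF \<mu>] by (subst integral_distr) auto
    also have "\<dots> = (\<Prod>i\<in>{1..n}. char (distr N borel (Y i (\<mu> i))) t)"
      using \<mu>le by (intro char_distr_sum Y_indep) auto
    also have "\<dots> = (\<Prod>i\<in>{1..n}. \<integral>\<omega>. iexp (t * Y i (\<mu> i) \<omega>) \<partial>N)"
      unfolding char_def using \<mu>le Y by (intro prod.cong refl, subst integral_distr) auto
    finally show ?thesis .
  qed
  have "(\<integral>\<omega>. iexp (t * (\<Sum>i\<in>{1..n}. Y i (I \<omega> i) \<omega>)) \<partial>N)
      = (\<integral>\<omega>. (\<Sum>\<mu>\<in>multi_indices n m.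
          indicator {\<mu>} (I \<omega>) * iexp (t * (\<Sum>i\<in>{1..n}. Y i (\<mu> i) \<omega>))) \<partial>N)"
    by (intro Bochner_Integration.integral_cong refl) (rule mixture_split[where G = "\<lambda>x. iexp (t * x)"])
  also have "\<dots> = (\<Sum>\<mu>\<in>multi_indices n m.
      \<integral>\<omega>. indicator {\<mu>} (I \<omega>) * iexp (t * (\<Sum>i\<in>{1..n}. Y i (\<mu> i) \<omega>)) \<partial>N)"
    by (rule Bochner_Integration.integral_sum) (rule int)
  also have "\<dots> = (\<Sum>\<mu>\<in>multi_indices n m. weight \<mu> * (\<Prod>i\<in>{1..n}. \<integral>\<omega>. iexp (t * Y i (\<mu> i) \<omega>) \<partial>N))"
    by (intro sum.cong refl) (rule summand)
  finally show ?thesis .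
qed

text \<open>
  The powers \<open>(\<i> t)\<^bsup>\<mu> i\<^esup>\<close> collected from the summands multiply to \<open>(\<i> t)\<^sup>m\<close>, and
  \<open>c \<mu>\<close> times the product of the \<open>\<alpha>\<close>-factors is \<open>\<alpha>\<close> of the sum times the probability of \<open>\<mu>\<close>. This is the Fourier relation for the
  sum, from which the bias identity follows.
\<close>

lemma mixture_biased:
  fixes M :: "'a measure" and X :: "nat \<Rightarrow> 'a \<Rightarrow> real"
  assumes M: "prob_space M" and X: "\<forall>i\<in>{1..n}. X i \<in> moment_class (L (ls i)) m M"
    and ind: "prob_space.indep_vars M (\<lambda>_. borel) X {1..n}"
    and biased: "\<And>i k. i \<in> {1..n} \<Longrightarrow> k \<le> m \<Longrightarrow>
      has_biased_distribution L P (ls i) k M (X i) N (Y i k)"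
  shows "has_biased_distribution L P l m M (\<lambda>\<omega>. \<Sum>i\<in>{1..n}. X i \<omega>)
          N (\<lambda>\<omega>. \<Sum>i\<in>{1..n}. Y i (I \<omega> i) \<omega>)"
proof -
  interpret M: prob_space M by fact
  interpret N: prob_space N by (rule N)
  define W where "W \<omega> = (\<Sum>i\<in>{1..n}. X i \<omega>)" for \<omega>
  define V where "V \<omega> = (\<Sum>i\<in>{1..n}. Y i (I \<omega> i) \<omega>)" for \<omega>
  have WM: "W \<in> moment_class (L l) m M"
    unfolding W_def[abs_def] by (rule sum_in_moment_class[OF M X ind])
  then have Wm [measurable]: "W \<in> borel_measurable M" by (simp add: moment_class_def)
  have Vm [measurable]: "V \<in> borel_measurable N"
    unfolding V_def[abs_def] by (rule mixture_measurable)
  have a_pos: "alpha L P l m > 0" by (rule alpha_P_pos[OF l_pos order_refl])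
  have iexp: "(\<integral>\<omega>. poly (P l m) (W \<omega>) * iexp (t * W \<omega>) \<partial>M)
      = alpha L P l m * (\<i> * t) ^ m * (\<integral>\<omega>. iexp (t * V \<omega>) \<partial>N)" for t
  proof -
    define \<phi> where "\<phi> \<mu> i = (\<integral>\<omega>. iexp (t * Y i (\<mu> i) \<omega>) \<partial>N)" for \<mu> :: "nat \<Rightarrow> nat" and i
    have "(\<integral>\<omega>. poly (P l m) (W \<omega>) * iexp (t * W \<omega>) \<partial>M)
        = (\<Sum>\<mu>\<in>multi_indices n m. c \<mu> *
        (\<Prod>i\<in>{1..n}. \<integral>\<omega>. poly (P (ls i) (\<mu> i)) (X i \<omega>) * iexp (t * X i \<omega>) \<partial>M))"
      unfolding W_def by (rule iexp_expectation_of_sum[OF M X ind])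
    also have "\<dots> = (\<Sum>\<mu>\<in>multi_indices n m.
        alpha L P l m * (\<i> * t) ^ m * (weight \<mu> * (\<Prod>i\<in>{1..n}. \<phi> \<mu> i)))"
    proof (intro sum.cong refl)
      fix \<mu> assume \<mu>: "\<mu> \<in> multi_indices n m"
      have "(\<integral>\<omega>. poly (P (ls i) (\<mu> i)) (X i \<omega>) * iexp (t * X i \<omega>) \<partial>M)
          = alpha L P (ls i) (\<mu> i) * (\<i> * t) ^ \<mu> i * \<phi> \<mu> i" if i: "i \<in> {1..n}" for i
      proof -
        have a: "ls i > 0" using ls_pos i by simp
        have "degree (P (ls i) (\<mu> i)) \<le> 2 * m" using degree_P[OF a] multi_index_le[OF \<mu> i] by simp
        then have "integrable M (\<lambda>\<omega>. poly (P (ls i) (\<mu> i)) (X i \<omega>))"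
          using moment_class_poly(1)[OF _ law[OF a] moment[OF a] M] X i by auto
        then show ?thesis unfolding \<phi>_def
          by (rule has_biased_distribution_iexp[OF biased[OF i multi_index_le[OF \<mu> i]] N])
      qed
      then have "(\<Prod>i\<in>{1..n}. \<integral>\<omega>. poly (P (ls i) (\<mu> i)) (X i \<omega>) * iexp (t * X i \<omega>) \<partial>M)
          = multi_alpha L P n ls \<mu> * (\<i> * t) ^ (\<Sum>i\<in>{1..n}. \<mu> i) * (\<Prod>i\<in>{1..n}. \<phi> \<mu> i)"
        by (simp add: prod.distrib multi_alpha_def power_sum)
      also have "(\<Sum>i\<in>{1..n}. \<mu> i) = m" using \<mu> by (simp add: multi_indices_def)
      finally show "c \<mu> * (\<Prod>i\<in>{1..n}. \<integral>\<omega>. poly (P (ls i) (\<mu> i)) (X i \<omega>) * iexp (t * X i \<omega>) \<partial>M)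
          = alpha L P l m * (\<i> * t) ^ m * (weight \<mu> * (\<Prod>i\<in>{1..n}. \<phi> \<mu> i))"
        using a_pos by simp
    qed
    also have "\<dots> = alpha L P l m * (\<i> * t) ^ m * (\<integral>\<omega>. iexp (t * V \<omega>) \<partial>N)"
      unfolding V_def mixture_iexp \<phi>_def by (simp only: sum_distrib_left)
    finally show ?thesis .
  qed
  have poly_E: "integrable M (\<lambda>\<omega>. poly h (W \<omega>))" "(\<integral>\<omega>. poly h (W \<omega>) \<partial>M) = (\<integral>z. poly h z \<partial>L l)"
    if "degree h \<le> 2 * m" for h
    using moment_class_poly[OF WM law[OF l_pos] moment[OF l_pos] M that] by auto
  have dP: "degree (P l m) = m" "lead_coeff (P l m) = 1"
    using degree_P lead_coeff_P l_pos by auto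
  have E_mult: "(\<integral>\<omega>. poly (P l m) (W \<omega>) * poly h (W \<omega>) \<partial>M) = (\<integral>z. poly h z * poly (P l m) z \<partial>L l)"
    if "degree h \<le> m" for h
  proof -
    have "degree (P l m * h) \<le> 2 * m" using dP that by (intro order_trans[OF degree_mult_le]) auto
    from poly_E(2)[OF this] show ?thesis by (simp add: mult.commute)
  qed
  note sys = law[OF l_pos] moment[OF l_pos] orth[OF l_pos]
  have "(\<integral>\<omega>. poly (P l m) (W \<omega>) * F (W \<omega>) \<partial>M) = alpha L P l m * (\<integral>\<omega>. (deriv ^^ m) F (V \<omega>) \<partial>N)"
    if F: "F \<in> test_functions m (P l m) M W" and int: "integrable N (\<lambda>\<omega>. (deriv ^^ m) F (V \<omega>))" for F
  proof -
    define D where "D j = (deriv ^^ j) F" for j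
    have der: "(D j has_real_derivative D (Suc j) x) (at x)" if "j < m" for j x
      using F that field_differentiable_derivI by (auto simp: test_functions_def D_def)
    have Dm [measurable]: "D m \<in> borel_measurable borel" using F by (simp add: test_functions_def D_def)
    have Fm [measurable]: "F \<in> borel_measurable borel"
    proof (cases "m = 0")
      case True
      then show ?thesis using Dm by (simp add: D_def)
    next
      case False
      then have "continuous_on UNIV (D 0)"
        by (auto intro!: continuous_at_imp_continuous_on DERIV_isCont der)
      then show ?thesis by (simp add: D_def borel_measurable_continuous_onI)
    qed
    have "(\<integral>x. poly (P l m) x * D 0 x \<partial>distr M borel W)
        = alpha L P l m * (\<integral>y. D m y \<partial>distr N borel V)"
    proof (rule biased_identity_of_iexp_identity[OF _ _ dP])
      show "real_distribution (distr M borel W)" by (rule M.real_distribution_distr) simp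
      show "real_distribution (distr N borel V)" by (rule N.real_distribution_distr) simp
      show "integrable (distr M borel W) (\<lambda>x. x ^ (2 * m))"
        using WM by (subst integrable_distr_eq) (auto simp: moment_class_def)
      show "(\<integral>x. poly (P l m) x * x ^ j \<partial>distr M borel W) = 0" if "j < m" for j
        using E_mult[of "monom 1 j"] orthogonal_system_lower_degree[OF sys order_refl, of "monom 1 j"] that
        by (subst integral_distr) (auto simp: poly_monom degree_monom_eq)
      show "(\<integral>x. (poly (P l m) x)\<^sup>2 \<partial>distr M borel W) > 0"
        using E_mult[of "P l m"] orth[OF l_pos] dP
        by (subst integral_distr) (auto simp: power2_eq_square orthogonal_polynomial_system_def)
      show "alpha L P l m = (\<integral>x. poly (P l m) x * x ^ m \<partial>distr M borel W) / fact m"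
        using E_mult[of "monom 1 m"]
        by (subst integral_distr) (auto simp: poly_monom degree_monom_eq alpha_def)
      show "(\<integral>x. poly (P l m) x * iexp (t * x) \<partial>distr M borel W)
          = alpha L P l m * (\<i> * t) ^ m * char (distr N borel V) t" for t
      proof -
        have "(\<integral>x. poly (P l m) x * iexp (t * x) \<partial>distr M borel W)
            = (\<integral>\<omega>. poly (P l m) (W \<omega>) * iexp (t * W \<omega>) \<partial>M)"
          by (rule integral_distr) measurable
        moreover have "char (distr N borel V) t = (\<integral>\<omega>. iexp (t * V \<omega>) \<partial>N)"
          unfolding char_def by (rule integral_distr) measurable
        ultimately show ?thesis by (simp only: iexp)
      qed
      show "integrable (distr N borel V) (D m)"
        using int by (subst integrable_distr_eq) (auto simp: D_def[symmetric])
    qed (use a_pos der Dm in auto)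
    moreover have "(\<integral>x. poly (P l m) x * D 0 x \<partial>distr M borel W)
        = (\<integral>\<omega>. poly (P l m) (W \<omega>) * F (W \<omega>) \<partial>M)"
      by (subst integral_distr) (auto simp: D_def)
    moreover have "(\<integral>y. D m y \<partial>distr N borel V) = (\<integral>\<omega>. (deriv ^^ m) F (V \<omega>) \<partial>N)"
      by (subst integral_distr) (auto simp: D_def[symmetric])
    ultimately show ?thesis by simp
  qed
  then show ?thesis
    using WM Vm unfolding W_def[abs_def] V_def[abs_def] has_biased_distribution_def by blast
qed

end

end

theorem theorem3p1:
  fixes m n :: nat
    and L :: "real \<Rightarrow> real measure"
    and P :: "real \<Rightarrow> nat \<Rightarrow> real poly"
    and c :: "(nat \<Rightarrow> nat) \<Rightarrow> real"
    and ls :: "nat \<Rightarrow> real"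
    and l :: real
  assumes "n \<ge> 1"
    and "\<And>a. a > 0 \<Longrightarrow> real_distribution (L a)"
    and "closed_under_independent_addition L"
    and "\<And>a. a > 0 \<Longrightarrow> integrable (L a) (\<lambda>z. z ^ (2 * m))"
    and "\<And>a. a > 0 \<Longrightarrow> orthogonal_polynomial_system (L a) m (P a)"
    and "\<And>(a :: nat \<Rightarrow> real) (x :: nat \<Rightarrow> real). (\<forall>i\<in>{1..n}. a i > 0) \<Longrightarrow>
           poly (P (\<Sum>i\<in>{1..n}. a i) m) (\<Sum>i\<in>{1..n}. x i) =
             (\<Sum>\<mu>\<in>multi_indices n m. c \<mu> * multi_poly P n a \<mu> x)"
    and "\<forall>i\<in>{1..n}. ls i > 0"
    and "l = (\<Sum>i\<in>{1..n}. ls i)"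
  shows
    "alpha L P l m = (\<Sum>\<mu>\<in>multi_indices n m. c \<mu> * multi_alpha L P n ls \<mu>) \<and>
     (\<exists>J :: (nat \<Rightarrow> nat) pmf. set_pmf J \<subseteq> multi_indices n m \<and>
        (\<forall>\<mu>\<in>multi_indices n m. pmf J \<mu> = c \<mu> * (multi_alpha L P n ls \<mu> / alpha L P l m))) \<and>
     (\<forall>(M :: 'a measure) (X :: nat \<Rightarrow> 'a \<Rightarrow> real)
       (N :: 'b measure) (Y :: nat \<Rightarrow> nat \<Rightarrow> 'b \<Rightarrow> real) (I :: 'b \<Rightarrow> nat \<Rightarrow> nat).
        prob_space M \<longrightarrow>
        (\<forall>i\<in>{1..n}. X i \<in> moment_class (L (ls i)) m M) \<longrightarrow>
        prob_space.indep_vars M (\<lambda>_. borel) X {1..n} \<longrightarrow>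
        prob_space N \<longrightarrow>
        (\<forall>i\<in>{1..n}. \<forall>k\<le>m. has_biased_distribution L P (ls i) k M (X i) N (Y i k)) \<longrightarrow>
        (\<forall>\<kappa> \<in> {1..n} \<rightarrow> {0..m}.
           prob_space.indep_vars N (\<lambda>_. borel) (\<lambda>i. Y i (\<kappa> i)) {1..n}) \<longrightarrow>
        (\<forall>\<mu>\<in>multi_indices n m.
           measure N {\<omega> \<in> space N. I \<omega> = \<mu>} = c \<mu> * (multi_alpha L P n ls \<mu> / alpha L P l m)) \<longrightarrow>
        indep_pair N (count_space (multi_indices n m)) I
          (PiM ({1..n} \<times> {0..m}) (\<lambda>_. borel :: real measure)) (\<lambda>\<omega>. \<lambda>p\<in>{1..n} \<times> {0..m}. Y (fst p) (snd p) \<omega>) \<longrightarrow>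
        has_biased_distribution L P l m M (\<lambda>\<omega>. \<Sum>i\<in>{1..n}. X i \<omega>)
          N (\<lambda>\<omega>. \<Sum>i\<in>{1..n}. Y i (I \<omega> i) \<omega>))"
proof -
  interpret A: additive_polynomial_family m n L P c ls
    using assms(1-7) by (rule additive_polynomial_family.intro)
  show ?thesis
    unfolding assms(8)
  proof (intro conjI allI impI)
    fix M :: "'a measure" and X :: "nat \<Rightarrow> 'a \<Rightarrow> real"
      and N :: "'b measure" and Y :: "nat \<Rightarrow> nat \<Rightarrow> 'b \<Rightarrow> real" and I :: "'b \<Rightarrow> nat \<Rightarrow> nat"
    assume M: "prob_space M" and X: "\<forall>i\<in>{1..n}. X i \<in> moment_class (L (ls i)) m M"
      and X_indep: "prob_space.indep_vars M (\<lambda>_. borel) X {1..n}"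
      and N: "prob_space N"
      and biased: "\<forall>i\<in>{1..n}. \<forall>k\<le>m. has_biased_distribution L P (ls i) k M (X i) N (Y i k)"
      and Y_indep: "\<forall>\<kappa> \<in> {1..n} \<rightarrow> {0..m}.
           prob_space.indep_vars N (\<lambda>_. borel) (\<lambda>i. Y i (\<kappa> i)) {1..n}"
      and I: "\<forall>\<mu>\<in>multi_indices n m. measure N {\<omega> \<in> space N. I \<omega> = \<mu>} = A.weight \<mu>"
      and I_indep: "indep_pair N (count_space (multi_indices n m)) I
          (PiM ({1..n} \<times> {0..m}) (\<lambda>_. borel :: real measure))
          (\<lambda>\<omega>. \<lambda>p\<in>{1..n} \<times> {0..m}. Y (fst p) (snd p) \<omega>)"
    have Y: "Y i k \<in> borel_measurable N" if "i \<in> {1..n}" "k \<le> m" for i k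
      using biased that by (auto simp: has_biased_distribution_def)
    show "has_biased_distribution L P A.l m M (\<lambda>\<omega>. \<Sum>i\<in>{1..n}. X i \<omega>)
          N (\<lambda>\<omega>. \<Sum>i\<in>{1..n}. Y i (I \<omega> i) \<omega>)"
      by (rule A.mixture_biased[OF N Y _ _ I_indep M X X_indep]) (use Y_indep I biased in auto)
  qed (rule A.alpha_sum A.weight_pmf)+
qed

end
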